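(* Let $K$ be a compact Calderón–Zygmund kernel on $\mathbb R^n$ with parameter $0<\delta<1$ and auxiliary functions $L,S,D$, and let $T$ be a linear operator associated with $K$ which satisfies the weak compactness condition with function $F_W$. Assume the special cancellation conditions $T(1)=T^{*}(1)=0$. Let $\delta<\alpha\le 1$. Then for all cubes $I,J\subset\mathbb R^n$ and all bump functions $\psi_I,\psi_J$ adapted to and supported on $I,J$ respectively, with constant $C>0$, order one and parameter $\alpha$, and such that $\psi_{I\wedge J}$ has mean zero, $$ |\langle T(\psi_I),\psi_J\rangle|\lesssim C^2\,\frac{\mathrm{ec}(I,J)^{\frac12+\frac{\delta}{n}}}{\mathrm{rdist}(I,J)^{n+\delta}}\,F(I,J), $$ where (i) $F(I,J)=F_K(\langle I,J\rangle,\, I\wedge J,\, \langle I,J\rangle)$ when $\mathrm{rdist}(I,J)>3$; (ii) $F(I,J)=\tilde F_K(I\vee J,\, I\wedge J,\, I\vee J)+F_W(I\wedge J)+F_K(I\wedge J,\, I\wedge J,\, I\vee J)$ when $\mathrm{rdist}(I,J)\le 3$. The implicit constant depends only on $T$, $\delta$ and $\alpha$.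
   Context: **Cubes.** A cube is $I=\prod_{i=1}^n[a_i,b_i]$ with all $b_i-a_i>0$ equal; $c(I)$ is its centre, $\ell(I)$ its side length, $|I|=\ell(I)^n$; $\lambda I$ is the cube with the same centre and side $\lambda\ell(I)$. $|\cdot|_\infty$ is the max norm on $\mathbb R^n$, $\mathbb B=[-1/2,1/2]^n$. $\langle I,J\rangle$ is the cube containing $I\cup J$ with smallest possible side length and whose centre has smallest possible first coordinate (any fixed choice if this is not unique); $\mathrm{diam}(I\cup J)=\ell(\langle I,J\rangle)$. For points, $\langle t,x\rangle$ is defined the same way, treating points as degenerate cubes. Put $$\mathrm{rdist}(I,J)=\frac{\mathrm{diam}(I\cup J)}{\max(\ell(I),\ell(J))},\qquad \mathrm{ec}(I,J)=\frac{\min(|I|,|J|)}{\max(|I|,|J|)}.$$ If $\ell(J)\le\ell(I)$ then $I\wedge J=J$, $I\vee J=I$; otherwise $I\wedge J=I$, $I\vee J=J$. **Kernel.** $K$ is defined on $\{(t,x)\in\mathbb R^n\times\mathbb R^n: t\ne x\}$ with values in $\mathbb C$. $L,S,D:[0,\infty)\to[0,\infty)$ are bounded, $L,D$ non-increasing, $S$ non-decreasing, with $\lim_{y\to\infty}L(y)=\lim_{y\to0}S(y)=\lim_{y\to\infty}D(y)=0$. That $K$ is a compact Calderón–Zygmund kernel with parameter $\delta$ and functions $L,S,D$ means (this is the working form of the definition): for some constant $C_K>0$, $$|K(t,x)-K(t',x')|\le C_K\frac{(|t-t'|_\infty+|x-x'|_\infty)^{\delta}}{|t-x|_\infty^{n+\delta}}\,L(|t-x|_\infty)\,S(|t-t'|_\infty+|x-x'|_\infty)\,D\Big(1+\frac{|t+x|_\infty}{1+|t-x|_\infty}\Big)$$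 whenever $2(|t-t'|_\infty+|x-x'|_\infty)<|t-x|_\infty$, and $$|K(t,x)|\le C_K\frac{1}{|t-x|_\infty^{n}}\,L(|t-x|_\infty)\,S(|t-x|_\infty)\,D\Big(1+\frac{|t+x|_\infty}{1+|t-x|_\infty}\Big)\quad (t\neq x).$$ **Functions $F_K$, $\tilde F_K$.** For cubes $I_1,I_2,I_3$, $$F_K(I_1,I_2,I_3)=L(\ell(I_1))\,S(\ell(I_2))\,D(\mathrm{rdist}(I_3,\mathbb B)),\qquad \tilde F_K(I_1,I_2,I_3)=L(\ell(I_1))\,S(\ell(I_2))\sum_{j\ge0}2^{-j\delta}D(\mathrm{rdist}(2^jI_3,\mathbb B)).$$ **Convention on constants.** Universal constants inside the arguments of $L,S,D$ are omitted: an estimate involving $F_K$, $\tilde F_K$ is understood to hold after replacing $L,S,D$ in their definitions by $L(\kappa\,\cdot),S(\kappa^{-1}\cdot),D(\kappa\,\cdot)$ for some constant $\kappa\in(0,1]$ depending only on $n$ and $\delta$. **Operator.** $\mathcal C_0(\mathbb R^n)$ denotes the continuous functions with compact support. $T:\mathcal C_0(\mathbb R^n)\to\mathcal C_0(\mathbb R^n)'$ is continuous and linear, with (bilinear) dual pairing $\langle T(f),g\rangle$. It is associated with $K$ if $\langle T(f),g\rangle=\iint f(t)g(x)K(x,t)\,dt\,dx$ for all $f,g\in\mathcal C_0(\mathbb R^n)$ with disjoint compact supports. $T^*$ is given by $\langle T^*(f),g\rangle=\langle T(g),f\rangle$. **Bump functions** ($L^2$-normalized). Fix a decay exponent $N\in\mathbb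 N$. A bounded $\phi$ is a bump function adapted to $I$ with constant $C$, decay $N$, order $0$ if $|\phi(x)|\le C|I|^{-1/2}\big(1+\frac{|x-c(I)|_\infty}{\ell(I)}\big)^{-N}$ for all $x$. A continuous bounded $\phi$ is a bump function adapted to $I$ with constant $C$, decay $N$, order one and parameter $\alpha\in(0,1]$ if moreover, for all $t,x$, $$|\phi(t)-\phi(x)|\le C\Big(\frac{|t-x|_\infty}{\ell(I)}\Big)^{\alpha}|I|^{-1/2}\sup_{r\in\langle t,x\rangle}\Big(1+\frac{|r-c(I)|_\infty}{\ell(I)}\Big)^{-N}.$$ Bump functions in the claim have decay $N$. **Weak compactness condition.** There is a bounded function $F_W$ from cubes to $[0,\infty)$ with $\lim_{\ell(I)\to\infty}F_W(I)=\lim_{\ell(I)\to0}F_W(I)=\lim_{|c(I)|_\infty\to\infty}F_W(I)=0$ such that $|\langle T(\phi_I),\varphi_I\rangle|\lesssim C^2F_W(I)$ for every cube $I$ and all bump functions $\phi_I,\varphi_I$ (in $\mathcal C_0(\mathbb R^n)$) adapted to $I$ with constant $C$, decay $N$, order $0$, the implicit constant depending only on $T$. **Cancellation.** $T(1)$ acts on compactly supported $\psi\in\mathcal C_0(\mathbb R^n)$ with mean zero, supported in a cube $J$, by $$\langle T(1),\psi\rangle=\langle T(\Phi),\psi\rangle+\iint(1-\Phi(t))\psi(x)\,(K(x,t)-K(c(J),t))\,dt\,dx,$$ where $\Phi\in \mathcal C_0(\mathbb R^n)$ is any smooth function with $0\le\Phi\le1$ and $\Phi(t)=1$ for $|t-c(J)|_\infty\le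 \ell(J)$ (the value does not depend on $\Phi$). $T(1)=0$ means this vanishes for all such $\psi$; $T^*(1)=0$ is the same condition for $T^*$, whose kernel is $K(t,x)$ with variables exchanged. *)

theory Defs
  imports "HOL-Analysis.Analysis"
begin

text \<open>The max norm on \<^typ>\<open>real^'n\<close> is the library's \<^const>\<open>infnorm\<close>. The index type carries
  a linear order only so that ``the first coordinate'' makes sense.\<close>

subsection \<open>Cubes\<close>

text \<open>A cube is stored as its centre and side length. Proper cubes have positive side
  (\<open>I \<in> cubes\<close>); points are the degenerate cubes of side \<open>0\<close>. On nonnegative sides this
  representation is in bijection with the sets \<open>cube_set I\<close>.\<close>

datatype ('n::finite) cube = Cube (center: "real^'n") (side: real)

definition cubes :: "('n::finite) cube set" where
  "cubes = {I. 0 < side I}"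

definition cube_set :: "('n::finite) cube \<Rightarrow> (real^'n) set" where
  "cube_set I = cbox (center I - vec (side I / 2)) (center I + vec (side I / 2))"

definition cube_vol :: "('n::finite) cube \<Rightarrow> real" where
  "cube_vol I = side I ^ CARD('n)"

definition dilate :: "real \<Rightarrow> ('n::finite) cube \<Rightarrow> 'n cube" where
  "dilate r I = Cube (center I) (r * side I)"

definition unit_cube :: "('n::finite) cube" where
  "unit_cube = Cube 0 1"

definition is_smallest_cube :: "(real^('n::{finite,linorder})) set \<Rightarrow> 'n cube \<Rightarrow> bool" where
  "is_smallest_cube A Q \<longleftrightarrow>
     0 \<le> side Q \<and> A \<subseteq> cube_set Q \<and>
     (\<forall>Q'. 0 \<le> side Q' \<and> A \<subseteq> cube_set Q' \<longrightarrow>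
        side Q \<le> side Q' \<and>
        (side Q' = side Q \<longrightarrow> center Q $ Min UNIV \<le> center Q' $ Min UNIV))"

text \<open>Covers both \<open>\<langle>I,J\<rangle>\<close> (as \<open>smallest_cube (cube_set I \<union> cube_set J)\<close>) and \<open>\<langle>t,x\<rangle>\<close>
  (as \<open>smallest_cube {t, x}\<close>). The remaining freedom in the other coordinates of the
  centre is resolved by an arbitrary choice.\<close>

definition smallest_cube :: "(real^('n::{finite,linorder})) set \<Rightarrow> 'n cube" where
  "smallest_cube A = (SOME Q. is_smallest_cube A Q)"

definition cube_hull :: "('n::{finite,linorder}) cube \<Rightarrow> 'n cube \<Rightarrow> 'n cube" where
  "cube_hull I J = smallest_cube (cube_set I \<union> cube_set J)"

definition rdist :: "('n::{finite,linorder}) cube \<Rightarrow> 'n cube \<Rightarrow> real" where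
  "rdist I J = side (cube_hull I J) / max (side I) (side J)"

definition ec :: "('n::finite) cube \<Rightarrow> 'n cube \<Rightarrow> real" where
  "ec I J = min (cube_vol I) (cube_vol J) / max (cube_vol I) (cube_vol J)"

definition cube_meet :: "('n::finite) cube \<Rightarrow> 'n cube \<Rightarrow> 'n cube" where
  "cube_meet I J = (if side J \<le> side I then J else I)"

definition cube_join :: "('n::finite) cube \<Rightarrow> 'n cube \<Rightarrow> 'n cube" where
  "cube_join I J = (if side J \<le> side I then I else J)"

subsection \<open>Compact Calderon--Zygmund kernels\<close>

text \<open>\<open>L\<close>, \<open>S\<close>, \<open>D\<close> are functions on \<open>[0,\<infinity>)\<close>; their values at negative reals are never
  used. Likewise the values of a kernel on the diagonal are irrelevant.\<close>

definition admissible_functions ::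
    "(real \<Rightarrow> real) \<Rightarrow> (real \<Rightarrow> real) \<Rightarrow> (real \<Rightarrow> real) \<Rightarrow> bool" where
  "admissible_functions L S D \<longleftrightarrow>
     (\<forall>y\<ge>0. 0 \<le> L y \<and> 0 \<le> S y \<and> 0 \<le> D y) \<and>
     bounded (L ` {0..}) \<and> bounded (S ` {0..}) \<and> bounded (D ` {0..}) \<and>
     antimono_on {0..} L \<and> mono_on {0..} S \<and> antimono_on {0..} D \<and>
     (L \<longlongrightarrow> 0) at_top \<and> (S \<longlongrightarrow> 0) (at_right 0) \<and> (D \<longlongrightarrow> 0) at_top"

definition compact_CZ_kernel ::
    "(real^('n::finite) \<Rightarrow> real^'n \<Rightarrow> complex) \<Rightarrow> real \<Rightarrow>
     (real \<Rightarrow> real) \<Rightarrow> (real \<Rightarrow> real) \<Rightarrow> (real \<Rightarrow> real) \<Rightarrow> bool" where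
  "compact_CZ_kernel K \<delta> L S D \<longleftrightarrow>
     admissible_functions L S D \<and>
     (\<exists>C\<^sub>K>0.
       (\<forall>t x t' x'. 2 * (infnorm (t - t') + infnorm (x - x')) < infnorm (t - x) \<longrightarrow>
          cmod (K t x - K t' x')
            \<le> C\<^sub>K * ((infnorm (t - t') + infnorm (x - x')) powr \<delta>
                     / infnorm (t - x) powr (real CARD('n) + \<delta>))
               * L (infnorm (t - x)) * S (infnorm (t - t') + infnorm (x - x'))
               * D (1 + infnorm (t + x) / (1 + infnorm (t - x)))) \<and>
       (\<forall>t x. t \<noteq> x \<longrightarrow>
          cmod (K t x)
            \<le> C\<^sub>K * (1 / infnorm (t - x) ^ CARD('n))
               * L (infnorm (t - x)) * S (infnorm (t - x))
               * D (1 + infnorm (t + x) / (1 + infnorm (t - x)))))"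

definition F_K ::
    "(real \<Rightarrow> real) \<Rightarrow> (real \<Rightarrow> real) \<Rightarrow> (real \<Rightarrow> real) \<Rightarrow>
     ('n::{finite,linorder}) cube \<Rightarrow> 'n cube \<Rightarrow> 'n cube \<Rightarrow> real" where
  "F_K L S D I\<^sub>1 I\<^sub>2 I\<^sub>3 = L (side I\<^sub>1) * S (side I\<^sub>2) * D (rdist I\<^sub>3 unit_cube)"

definition F_K_tilde ::
    "real \<Rightarrow> (real \<Rightarrow> real) \<Rightarrow> (real \<Rightarrow> real) \<Rightarrow> (real \<Rightarrow> real) \<Rightarrow>
     ('n::{finite,linorder}) cube \<Rightarrow> 'n cube \<Rightarrow> 'n cube \<Rightarrow> real" where
  "F_K_tilde \<delta> L S D I\<^sub>1 I\<^sub>2 I\<^sub>3 =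
     L (side I\<^sub>1) * S (side I\<^sub>2)
       * (\<Sum>j. 2 powr (- (real j * \<delta>)) * D (rdist (dilate (2 ^ j) I\<^sub>3) unit_cube))"

subsection \<open>Operators on continuous functions with compact support\<close>

definition supp :: "('a::topological_space \<Rightarrow> 'b::zero) \<Rightarrow> 'a set" where
  "supp f = closure {x. f x \<noteq> 0}"

definition C0 :: "(real^('n::finite) \<Rightarrow> complex) set" where
  "C0 = {f. continuous_on UNIV f \<and> compact (supp f)}"

text \<open>The topology of \<^const>\<open>C0\<close> is the usual inductive limit of the sup-normed spaces of
  functions supported in a fixed compact set \<open>M\<close>, so a linear functional is continuous iff
  it is bounded on each of these spaces.\<close>

definition C0_dual :: "((real^('n::finite) \<Rightarrow> complex) \<Rightarrow> complex) set" where
  "C0_dual = {\<Lambda>.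
     (\<forall>f\<in>C0. \<forall>g\<in>C0. \<Lambda> (\<lambda>x. f x + g x) = \<Lambda> f + \<Lambda> g) \<and>
     (\<forall>f\<in>C0. \<forall>c. \<Lambda> (\<lambda>x. c * f x) = c * \<Lambda> f) \<and>
     (\<forall>M. compact M \<longrightarrow>
        (\<exists>B. \<forall>f\<in>C0. supp f \<subseteq> M \<longrightarrow> cmod (\<Lambda> f) \<le> B * (SUP x. cmod (f x))))}"

text \<open>An operator is given by its pairing \<open>T f g = \<langle>T(f), g\<rangle>\<close>; only its values on
  \<^const>\<open>C0\<close> matter. The dual space carries the weak-* topology, so linearity and
  continuity of \<open>f \<mapsto> T(f)\<close> say that \<open>f \<mapsto> \<langle>T(f), g\<rangle>\<close> is linear and continuous for
  every \<open>g\<close>. (By Banach--Steinhaus the strong dual topology gives the same operators.)\<close>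

definition continuous_linear_operator ::
    "((real^('n::finite) \<Rightarrow> complex) \<Rightarrow> (real^'n \<Rightarrow> complex) \<Rightarrow> complex) \<Rightarrow> bool" where
  "continuous_linear_operator T \<longleftrightarrow>
     (\<forall>f\<in>C0. T f \<in> C0_dual) \<and> (\<forall>g\<in>C0. (\<lambda>f. T f g) \<in> C0_dual)"

definition adjoint_operator ::
    "((real^('n::finite) \<Rightarrow> complex) \<Rightarrow> (real^'n \<Rightarrow> complex) \<Rightarrow> complex) \<Rightarrow>
     (real^'n \<Rightarrow> complex) \<Rightarrow> (real^'n \<Rightarrow> complex) \<Rightarrow> complex" where
  "adjoint_operator T f g = T g f"

definition associated_with ::
    "((real^('n::finite) \<Rightarrow> complex) \<Rightarrow> (real^'n \<Rightarrow> complex) \<Rightarrow> complex) \<Rightarrow>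
     (real^'n \<Rightarrow> real^'n \<Rightarrow> complex) \<Rightarrow> bool" where
  "associated_with T K \<longleftrightarrow>
     (\<forall>f\<in>C0. \<forall>g\<in>C0. supp f \<inter> supp g = {} \<longrightarrow>
        T f g = (LINT x|lborel. LINT t|lborel. f t * g x * K x t))"

subsection \<open>Bump functions\<close>

definition bump_order0 ::
    "('n::finite) cube \<Rightarrow> real \<Rightarrow> nat \<Rightarrow> (real^'n \<Rightarrow> complex) \<Rightarrow> bool" where
  "bump_order0 I C N \<phi> \<longleftrightarrow>
     bounded (range \<phi>) \<and>
     (\<forall>x. cmod (\<phi> x)
        \<le> C * cube_vol I powr (-1/2) * (1 + infnorm (x - center I) / side I) powr (- real N))"

definition bump_order1 ::
    "'n cube \<Rightarrow> real \<Rightarrow> nat \<Rightarrow> real \<Rightarrow>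
     (real^('n::{finite,linorder}) \<Rightarrow> complex) \<Rightarrow> bool" where
  "bump_order1 I C N \<alpha> \<phi> \<longleftrightarrow>
     continuous_on UNIV \<phi> \<and> bump_order0 I C N \<phi> \<and>
     (\<forall>t x. cmod (\<phi> t - \<phi> x)
        \<le> C * (infnorm (t - x) / side I) powr \<alpha> * cube_vol I powr (-1/2)
           * (SUP r \<in> cube_set (smallest_cube {t, x}).
                (1 + infnorm (r - center I) / side I) powr (- real N)))"

subsection \<open>Weak compactness and cancellation\<close>

definition weak_compactness ::
    "((real^('n::finite) \<Rightarrow> complex) \<Rightarrow> (real^'n \<Rightarrow> complex) \<Rightarrow> complex) \<Rightarrow> nat \<Rightarrow>
     ('n cube \<Rightarrow> real) \<Rightarrow> bool" where
  "weak_compactness T N F\<^sub>W \<longleftrightarrow>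
     (\<forall>I\<in>cubes. 0 \<le> F\<^sub>W I) \<and> bounded (F\<^sub>W ` cubes) \<and>
     (F\<^sub>W \<longlongrightarrow> 0) (inf (filtercomap side at_top) (principal cubes)) \<and>
     (F\<^sub>W \<longlongrightarrow> 0) (inf (filtercomap side (at_right 0)) (principal cubes)) \<and>
     (F\<^sub>W \<longlongrightarrow> 0) (inf (filtercomap (\<lambda>I. infnorm (center I)) at_top) (principal cubes)) \<and>
     (\<exists>A. \<forall>I\<in>cubes. \<forall>C>0. \<forall>\<phi>\<in>C0. \<forall>\<eta>\<in>C0.
        bump_order0 I C N \<phi> \<and> bump_order0 I C N \<eta> \<longrightarrow>
        cmod (T \<phi> \<eta>) \<le> A * C\<^sup>2 * F\<^sub>W I)"

primrec C_k :: "nat \<Rightarrow> (real^('n::finite) \<Rightarrow> real) \<Rightarrow> bool" where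
  "C_k 0 f \<longleftrightarrow> continuous_on UNIV f"
| "C_k (Suc k) f \<longleftrightarrow>
     (\<forall>x. f differentiable (at x)) \<and>
     (\<forall>i. C_k k (\<lambda>x. frechet_derivative f (at x) (axis i 1)))"

definition smooth :: "(real^('n::finite) \<Rightarrow> real) \<Rightarrow> bool" where
  "smooth f \<longleftrightarrow> (\<forall>k. C_k k f)"

text \<open>\<open>\<langle>T(1), \<psi>\<rangle>\<close>, computed with the cube \<open>J\<close> and the cutoff \<open>\<Phi>\<close>.\<close>

definition T1_pairing ::
    "((real^('n::finite) \<Rightarrow> complex) \<Rightarrow> (real^'n \<Rightarrow> complex) \<Rightarrow> complex) \<Rightarrow>
     (real^'n \<Rightarrow> real^'n \<Rightarrow> complex) \<Rightarrow> 'n cube \<Rightarrow> (real^'n \<Rightarrow> real) \<Rightarrow>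
     (real^'n \<Rightarrow> complex) \<Rightarrow> complex" where
  "T1_pairing T K J \<Phi> \<psi> =
     T (\<lambda>t. complex_of_real (\<Phi> t)) \<psi>
     + (LINT x|lborel. LINT t|lborel.
          complex_of_real (1 - \<Phi> t) * \<psi> x * (K x t - K (center J) t))"

text \<open>The pairing does not depend on the admissible cutoff, so it is required to vanish for
  all of them.\<close>

definition T1_eq_zero ::
    "((real^('n::finite) \<Rightarrow> complex) \<Rightarrow> (real^'n \<Rightarrow> complex) \<Rightarrow> complex) \<Rightarrow>
     (real^'n \<Rightarrow> real^'n \<Rightarrow> complex) \<Rightarrow> bool" where
  "T1_eq_zero T K \<longleftrightarrow>
     (\<forall>J\<in>cubes. \<forall>\<psi>\<in>C0. \<forall>\<Phi>.
        supp \<psi> \<subseteq> cube_set J \<and> integral\<^sup>L lborel \<psi> = 0 \<and>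
        smooth \<Phi> \<and> compact (supp \<Phi>) \<and> (\<forall>t. 0 \<le> \<Phi> t \<and> \<Phi> t \<le> 1) \<and>
        (\<forall>t. infnorm (t - center J) \<le> side J \<longrightarrow> \<Phi> t = 1) \<longrightarrow>
        T1_pairing T K J \<Phi> \<psi> = 0)"

end

theory Submission
  imports Defs "HOL-Computational_Algebra.Polynomial"
begin

text \<open>By duality let \<open>J\<close> be the smaller cube, with centre \<open>c\<close>. If the cubes are far apart, the mean
  zero of \<open>\<psi>\<^sub>J\<close> replaces \<open>K(x,t)\<close> by \<open>K(x,t) - K(c,t)\<close> and the kernel regularity suffices.
  Otherwise take a smooth cutoff \<open>\<Phi>\<close> adapted to \<open>J\<close> and write
  \<open>\<psi>\<^sub>I = (\<psi>\<^sub>I - \<psi>\<^sub>I(c)) \<Phi> + (1 - \<Phi>) \<psi>\<^sub>I + \<psi>\<^sub>I(c) \<Phi>\<close>. The first summand is, by its Hoelder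
  continuity, a small multiple of a bump function adapted to \<open>J\<close>, so weak compactness applies.
  By \<open>T(1) = 0\<close> the other two add up to the integral of
  \<open>(1 - \<Phi>(t)) (\<psi>\<^sub>I(t) - \<psi>\<^sub>I(c)) \<psi>\<^sub>J(x) (K(x,t) - K(c,t))\<close>, which is summed over dyadic annuli around
  \<open>c\<close>: those of radius at most \<open>\<ell>(I)\<close> form a geometric series because \<open>\<alpha> > \<delta>\<close>, and the larger ones
  produce the series in \<^const>\<open>F_K_tilde\<close>.\<close>

subsection \<open>Cubes\<close>

text \<open>The obstacle is the singularity of \<open>K\<close> on the diagonal: where the supports
  overlap, the kernel does not represent \<open>T\<close>, and the first summand isolates this part.
  On the support of \<Phi> one has |t - c| \<le> 2n l(J), so the Hoelder bound of
  \<open>\<psi>\<^sub>I\<close> gives (l(J)/l(I))^\<alpha>, of which the power \<delta> is kept.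
  Together with |I|^(-1/2) = |J|^(-1/2) (l(J)/l(I))^(n/2) this is exactly ec(I,J)^(1/2 +
  \<delta>/n). In the remainder the power \<delta> comes instead from the numerator l(J)^\<delta> of
  the kernel regularity. On the inner annuli only |c - t| > l(J) is available for every radius at
  once, so \<open>L\<close> is frozen at l(J), which produces F_K(J,J,I); on the outer annuli it is
  frozen at l(I). For rdist(I,J) \<le> 3 the denominator rdist(I,J)^(n+\<delta>) lies between 1 and
  3^(n+\<delta>), so it can be inserted at the end at the cost of a constant. The single dilation
  constant 1/10 serves \<open>L\<close>, \<open>S\<close> and \<open>D\<close> in both
  regimes.\<close>

lemma infnorm_le_iff_cart: "infnorm (x::real^'n) \<le> r \<longleftrightarrow> (\<forall>i. \<bar>x $ i\<bar> \<le> r)"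
proof
  assume "infnorm x \<le> r"
  then show "\<forall>i. \<bar>x $ i\<bar> \<le> r"
    using component_le_infnorm_cart order_trans by blast
next
  assume "\<forall>i. \<bar>x $ i\<bar> \<le> r"
  then show "infnorm x \<le> r"
    unfolding infnorm_cart by (intro cSup_least) auto
qed

lemma mem_cube_set: "x \<in> cube_set I \<longleftrightarrow> infnorm (x - center I) \<le> side I / 2"
  unfolding cube_set_def infnorm_le_iff_cart mem_box_cart all_conj_distrib[symmetric]
  by (rule all_cong1) (simp add: abs_if, linarith)

lemma infnorm_cball_eq_cbox: "{t. infnorm (t - c) \<le> r} = cbox (c - vec r) (c + vec r)"
  unfolding infnorm_le_iff_cart set_eq_iff mem_box_cart mem_Collect_eq
  by (intro allI all_cong1) (auto simp: abs_le_iff)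

lemma emeasure_infnorm_cball:
  fixes c :: "real^'n"
  assumes "0 \<le> r"
  shows "emeasure lborel {t. infnorm (t - c) \<le> r} = ennreal ((2 * r) ^ CARD('n))"
proof -
  have "cbox (c - vec r) (c + vec r) \<noteq> {}"
    using assms by (auto simp: interval_eq_empty_cart not_less)
  then have "measure lborel (cbox (c - vec r) (c + vec r)) = (\<Prod>i\<in>(UNIV::'n set). 2 * r)"
    by (subst content_cbox_cart) (auto simp: algebra_simps)
  then show ?thesis
    unfolding infnorm_cball_eq_cbox
    by (subst emeasure_eq_ennreal_measure) (use emeasure_lborel_cbox_finite[of "c - vec r" "c + vec r"] in auto)
qed

lemma compact_cube_set: "compact (cube_set I)"
  unfolding cube_set_def by (rule compact_cbox)

lemma emeasure_cube_set: "0 \<le> side I \<Longrightarrow> emeasure lborel (cube_set I) = ennreal (cube_vol I)"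
  using emeasure_infnorm_cball[of "side I / 2" "center I"]
  unfolding infnorm_cball_eq_cbox cube_set_def cube_vol_def by simp

lemma cube_vol_pos: "I \<in> cubes \<Longrightarrow> 0 < cube_vol I"
  by (simp add: cubes_def cube_vol_def)

lemma center_mem_cube_set: "0 \<le> side I \<Longrightarrow> center I \<in> cube_set I"
  by (simp add: mem_cube_set infnorm_0)

section \<open>Smallest enclosing cubes and relative distance\<close>

text \<open>Existence for the \<open>SOME\<close> in \<open>smallest_cube\<close>. With
  \<open>lo\<close>, \<open>hi\<close> the bounding box and \<open>s\<close> its longest edge, every
  enclosing cube has side at least \<open>s\<close> and reaches up to \<open>hi i\<close> in each
  coordinate. Hence the cube of side \<open>s\<close> whose upper corner is \<open>hi\<close> has
  the least possible centre in every coordinate, in particular in the first.\<close>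

lemma is_smallest_cube_smallest_cube:
  fixes A :: "(real^('n::{finite,linorder})) set"
  assumes "bounded A" "A \<noteq> {}"
  shows "is_smallest_cube A (smallest_cube A)"
proof -
  define hi where "hi i = Sup ((\<lambda>x. x $ i) ` A)" for i
  define lo where "lo i = Inf ((\<lambda>x. x $ i) ` A)" for i
  define s where "s = Max (range (\<lambda>i. hi i - lo i))"
  obtain B where B: "\<And>x. x \<in> A \<Longrightarrow> norm x \<le> B"
    using assms(1) bounded_iff by blast
  have comp: "\<bar>x $ i\<bar> \<le> B" if "x \<in> A" for x i
    using B[OF that] component_le_norm_cart[of x i] by linarith
  have bdd: "bdd_above ((\<lambda>x. x $ i) ` A)" "bdd_below ((\<lambda>x. x $ i) ` A)" for i
  proof -
    have "x $ i \<le> B" "- B \<le> x $ i" if "x \<in> A" for x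
      using comp[OF that, of i] by linarith+
    then show "bdd_above ((\<lambda>x. x $ i) ` A)" and "bdd_below ((\<lambda>x. x $ i) ` A)"
      unfolding bdd_above_def bdd_below_def by blast+
  qed
  have hi: "x $ i \<le> hi i" and lo: "lo i \<le> x $ i" if "x \<in> A" for x i
    unfolding hi_def lo_def using that bdd[of i] by (auto intro: cSup_upper cInf_lower)
  have s: "hi i - lo i \<le> s" for i
    unfolding s_def by (rule Max_ge) auto
  obtain x0 where x0: "x0 \<in> A" using assms(2) by blast
  have "s \<ge> 0"
    using s[of undefined] hi[OF x0, of undefined] lo[OF x0, of undefined] by linarith
  have bound: "hi i \<le> center Q $ i + side Q / 2 \<and> center Q $ i - side Q / 2 \<le> lo i"
    if "A \<subseteq> cube_set Q" for Q i
  proof -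
    have "x $ i \<le> center Q $ i + side Q / 2" "center Q $ i - side Q / 2 \<le> x $ i" if "x \<in> A" for x
      using that \<open>A \<subseteq> cube_set Q\<close> by (auto simp: cube_set_def mem_box_cart subset_iff)
    then show ?thesis
      unfolding hi_def lo_def using assms(2) by (auto intro!: cSUP_least cINF_greatest)
  qed
  have "is_smallest_cube A (Cube (\<chi> i. hi i - s / 2) s)"
    unfolding is_smallest_cube_def
  proof (intro conjI allI impI)
    show "0 \<le> side (Cube (\<chi> i. hi i - s / 2) s)" using \<open>s \<ge> 0\<close> by simp
    show "A \<subseteq> cube_set (Cube (\<chi> i. hi i - s / 2) s)"
    proof
      fix x assume "x \<in> A"
      have "hi i - s \<le> x $ i" for i
        using lo[OF \<open>x \<in> A\<close>, of i] s[of i] by linarith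
      then show "x \<in> cube_set (Cube (\<chi> i. hi i - s / 2) s)"
        using hi[OF \<open>x \<in> A\<close>] by (auto simp: cube_set_def mem_box_cart)
    qed
  next
    fix Q :: "'n cube" assume Q: "0 \<le> side Q \<and> A \<subseteq> cube_set Q"
    have "hi i - lo i \<le> side Q" for i
      using bound[of Q i] Q by linarith
    then show "side (Cube (\<chi> i. hi i - s / 2) s) \<le> side Q"
      unfolding s_def by simp
    assume "side Q = side (Cube (\<chi> i. hi i - s / 2) s)"
    then show "center (Cube (\<chi> i. hi i - s / 2) s) $ Min UNIV \<le> center Q $ Min UNIV"
      using bound[of Q "Min UNIV"] Q by auto
  qed
  then show ?thesis
    unfolding smallest_cube_def by (rule someI)
qed

lemma is_smallest_cube_hull:
  assumes "I \<in> cubes" "J \<in> cubes"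
  shows "is_smallest_cube (cube_set I \<union> cube_set J) (cube_hull I J)"
  unfolding cube_hull_def
proof (rule is_smallest_cube_smallest_cube)
  show "bounded (cube_set I \<union> cube_set J)"
    by (simp add: compact_cube_set compact_imp_bounded)
  show "cube_set I \<union> cube_set J \<noteq> {}"
    using center_mem_cube_set[of I] assms by (auto simp: cubes_def)
qed

lemma cube_subset_hull:
  assumes "I \<in> cubes" "J \<in> cubes"
  shows "cube_set I \<subseteq> cube_set (cube_hull I J)" "cube_set J \<subseteq> cube_set (cube_hull I J)"
  using is_smallest_cube_hull[OF assms] unfolding is_smallest_cube_def by auto

lemma side_hull_le:
  assumes "I \<in> cubes" "J \<in> cubes" "0 \<le> s"
    "\<And>y. y \<in> cube_set I \<Longrightarrow> infnorm (y - c) \<le> s / 2"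
    "\<And>y. y \<in> cube_set J \<Longrightarrow> infnorm (y - c) \<le> s / 2"
  shows "side (cube_hull I J) \<le> s"
proof -
  have "cube_set I \<union> cube_set J \<subseteq> cube_set (Cube c s)"
    using assms(4,5) by (auto simp: mem_cube_set)
  then show ?thesis
    using is_smallest_cube_hull[OF assms(1,2)] assms(3) unfolding is_smallest_cube_def
    by (metis cube.sel(2))
qed

lemma infnorm_diff_le_of_mem_cube:
  assumes "x \<in> cube_set Q" "y \<in> cube_set Q"
  shows "infnorm (x - y) \<le> side Q"
  using infnorm_triangle[of "x - center Q" "center Q - y"] assms
  by (simp add: mem_cube_set infnorm_sub[of "center Q" y])

text \<open>Opposite corners of \<open>I\<close> are at max-norm distance exactly
  \<open>side I\<close>, while two points of \<open>Q\<close> are at distance at most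
  \<open>side Q\<close>.\<close>

lemma side_le_of_cube_subset:
  assumes "I \<in> cubes" "cube_set I \<subseteq> cube_set Q"
  shows "side I \<le> side Q"
proof -
  have n: "infnorm (vec r :: real^'a) = r" if "r \<ge> 0" for r :: real
    using that component_le_infnorm_cart[of "vec r :: real^'a" undefined]
    by (intro antisym) (auto simp: infnorm_le_iff_cart)
  have s: "0 \<le> side I" using assms(1) by (simp add: cubes_def)
  have "center I + vec (side I / 2) \<in> cube_set I" "center I - vec (side I / 2) \<in> cube_set I"
    using s n[of "side I / 2"] by (auto simp: mem_cube_set infnorm_neg)
  then have "infnorm ((center I + vec (side I / 2)) - (center I - vec (side I / 2))) \<le> side Q"
    using assms(2) by (intro infnorm_diff_le_of_mem_cube) auto
  moreover have "(center I + vec (side I / 2)) - (center I - vec (side I / 2)) = vec (side I)"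
    by (simp add: vec_eq_iff)
  ultimately show ?thesis using n[OF s] by simp
qed

lemma max_side_le_hull:
  assumes "I \<in> cubes" "J \<in> cubes"
  shows "max (side I) (side J) \<le> side (cube_hull I J)"
  using side_le_of_cube_subset cube_subset_hull assms by (metis max.bounded_iff)

lemma rdist_ge_1:
  assumes "I \<in> cubes" "J \<in> cubes"
  shows "1 \<le> rdist I J"
  using max_side_le_hull[OF assms] assms unfolding rdist_def cubes_def
  by (simp add: le_divide_eq)

lemma cube_hull_commute: "cube_hull I J = cube_hull J I"
  by (simp add: cube_hull_def Un_commute)

lemma rdist_commute: "rdist I J = rdist J I"
  by (simp add: rdist_def cube_hull_commute max.commute)

lemma ec_commute: "ec I J = ec J I"
  by (simp add: ec_def max.commute min.commute)

section \<open>Comparing the geometry of cubes with the arguments of the kernel bound\<close>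

text \<open>A cube centred at the origin encloses both cubes. The bound is put in terms of |c(Q)| /
  max(l(Q), 1) because this quotient can be compared with |t+x| / (1+|t-x|), on which
  \<open>D\<close> depends in the kernel estimate.\<close>

lemma rdist_unit_cube_le:
  fixes Q :: "('n::{finite,linorder}) cube"
  assumes "Q \<in> cubes"
  shows "rdist Q unit_cube \<le> 2 + 2 * infnorm (center Q) / max (side Q) 1"
proof -
  have s: "0 < side Q" using assms by (simp add: cubes_def)
  have "side (cube_hull Q unit_cube) \<le> 2 * infnorm (center Q) + side Q + 1"
  proof (rule side_hull_le)
    show "(unit_cube :: 'n cube) \<in> cubes" by (simp add: cubes_def unit_cube_def)
    show "infnorm (y - 0) \<le> (2 * infnorm (center Q) + side Q + 1) / 2"
      if "y \<in> cube_set Q" for y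
      using infnorm_triangle[of "y - center Q" "center Q"] that by (simp add: mem_cube_set)
    show "infnorm (y - 0) \<le> (2 * infnorm (center Q) + side Q + 1) / 2"
      if "y \<in> cube_set unit_cube" for y
      using that s infnorm_pos_le[of "center Q"] by (simp add: mem_cube_set unit_cube_def)
  qed (use assms s infnorm_pos_le[of "center Q"] in auto)
  also have "\<dots> \<le> 2 * max (side Q) 1 + 2 * infnorm (center Q)" by simp
  finally have "rdist Q unit_cube \<le> (2 * max (side Q) 1 + 2 * infnorm (center Q)) / max (side Q) 1"
    unfolding rdist_def by (auto simp: unit_cube_def intro!: divide_right_mono)
  also have "\<dots> = 2 + 2 * infnorm (center Q) / max (side Q) 1"
    by (simp add: add_divide_distrib max_def)
  finally show ?thesis .
qed

text \<open>This is where the dilation constant \<open>1/10\<close> comes from.\<close>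

lemma rdist_unit_cube_le_kernel_argument:
  fixes Q :: "('n::{finite,linorder}) cube"
  assumes "Q \<in> cubes" "infnorm (c - t) \<le> 2 * side Q" "infnorm (c - center Q) \<le> 3 * side Q"
  shows "rdist Q unit_cube / 10 \<le> 1 + infnorm (c + t) / (1 + infnorm (c - t))"
proof -
  define M where "M = max (side Q) 1"
  have M: "1 \<le> M" "side Q \<le> M" by (auto simp: M_def)
  have "2 * infnorm (center Q) = infnorm (2 *\<^sub>R center Q)" by (simp add: infnorm_mul)
  \<comment> \<open>Only c + t may survive; the other two terms cost at most 2 and 6 sides of
    \<open>Q\<close>. These 8, plus the 2 from \<open>rdist_unit_cube_le\<close>, make the
    10.\<close>
  also have "2 *\<^sub>R center Q = (c + t) + (c - t) - 2 *\<^sub>R (c - center Q)"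
    by (simp add: algebra_simps scaleR_2)
  also have "infnorm \<dots> \<le> infnorm (c + t) + infnorm (c - t) + 2 * infnorm (c - center Q)"
    using infnorm_triangle[of "(c + t) + (c - t)" "- (2 *\<^sub>R (c - center Q))"]
      infnorm_triangle[of "c + t" "c - t"] by (simp add: infnorm_neg infnorm_mul)
  also have "\<dots> \<le> infnorm (c + t) + 8 * M" using assms M by linarith
  finally have "2 * infnorm (center Q) / M \<le> (infnorm (c + t) + 8 * M) / M"
    using M by (intro divide_right_mono) auto
  also have "\<dots> = infnorm (c + t) / M + 8" using M by (simp add: field_simps)
  finally have 1: "rdist Q unit_cube \<le> 10 + infnorm (c + t) / M"
    using rdist_unit_cube_le[OF assms(1)] unfolding M_def by linarith
  \<comment> \<open>Since 1 + |c-t| \<le> 3M, division by M costs a factor 3 against the kernel's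
    quotient, well within the 10 already lost.\<close>
  have "infnorm (c + t) * (1 + infnorm (c - t)) \<le> infnorm (c + t) * (3 * M)"
    using assms(2) M by (intro mult_left_mono) (auto simp: infnorm_pos_le)
  then have "infnorm (c + t) / M \<le> 3 * (infnorm (c + t) / (1 + infnorm (c - t)))"
    using M infnorm_pos_le[of "c - t"] by (simp add: field_simps)
  moreover have "0 \<le> infnorm (c + t) / (1 + infnorm (c - t))"
    by (simp add: infnorm_pos_le)
  ultimately show ?thesis using 1 by linarith
qed

text \<open>The cube centred at the midpoint of \<open>x\<close> and \<open>t\<close> with side 2
  l(I) + |x-t| contains both cubes, hence the hull is no larger. The threshold 3 makes the hull
  longer than 3 l(I), so |x-t| exceeds both l(I) and a third of the hull.\<close>

lemma far_cubes_separated: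
  fixes I J :: "('n::{finite,linorder}) cube"
  assumes "I \<in> cubes" "J \<in> cubes" "side J \<le> side I" "3 < rdist I J"
    "t \<in> cube_set I" "x \<in> cube_set J"
  shows "side (cube_hull I J) / 3 \<le> infnorm (x - t)" "side I < infnorm (x - t)"
proof -
  have s: "0 < side I" "0 < side J" using assms by (auto simp: cubes_def)
  define m where "m = (1/2) *\<^sub>R (x + t)"
  have xm: "x - m = (1/2) *\<^sub>R (x - t)" and tm: "t - m = (1/2) *\<^sub>R (t - x)"
    unfolding m_def by (simp_all add: vec_eq_iff field_simps)
  have m: "infnorm (x - m) = infnorm (x - t) / 2" "infnorm (t - m) = infnorm (x - t) / 2"
    unfolding xm tm by (simp_all add: infnorm_mul infnorm_sub[of t x])
  have hull: "side (cube_hull I J) \<le> 2 * side I + infnorm (x - t)"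
  proof (rule side_hull_le[OF assms(1,2)])
    show "infnorm (y - m) \<le> (2 * side I + infnorm (x - t)) / 2" if "y \<in> cube_set I" for y
      using infnorm_triangle[of "y - t" "t - m"] infnorm_diff_le_of_mem_cube[OF that assms(5)] m
      by simp
    show "infnorm (y - m) \<le> (2 * side I + infnorm (x - t)) / 2" if "y \<in> cube_set J" for y
      using infnorm_triangle[of "y - x" "x - m"] infnorm_diff_le_of_mem_cube[OF that assms(6)] m
        assms(3) by simp
    show "0 \<le> 2 * side I + infnorm (x - t)" using s infnorm_pos_le[of "x - t"] by linarith
  qed
  have "3 * side I < side (cube_hull I J)"
    using assms(3,4) s by (simp add: rdist_def field_simps max_def split: if_splits)
  with hull show "side (cube_hull I J) / 3 \<le> infnorm (x - t)" "side I < infnorm (x - t)"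
    by linarith+
qed

text \<open>Provides the hypothesis on centres in \<open>rdist_unit_cube_le_kernel_argument\<close>
  for the larger cube and its dilates.\<close>

lemma infnorm_centers_le:
  assumes "I \<in> cubes" "J \<in> cubes" "side J \<le> side I" "rdist I J \<le> 3"
  shows "infnorm (center J - center I) \<le> 3 * side I"
proof -
  have s: "0 < side I" "0 < side J" using assms by (auto simp: cubes_def)
  have "side (cube_hull I J) \<le> 3 * side I"
    using assms(3,4) s by (simp add: rdist_def field_simps max_def split: if_splits)
  moreover have "infnorm (center J - center I) \<le> side (cube_hull I J)"
    using cube_subset_hull[OF assms(1,2)] center_mem_cube_set[of I] center_mem_cube_set[of J] s
    by (intro infnorm_diff_le_of_mem_cube) auto
  ultimately show ?thesis by linarith
qed

lemma ec_powr:
  fixes I J :: "('n::{finite,linorder}) cube"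
  assumes "I \<in> cubes" "J \<in> cubes" "side J \<le> side I"
  shows "ec I J powr (1/2 + \<delta> / real CARD('n)) = (side J / side I) powr (real CARD('n) / 2 + \<delta>)"
proof -
  have s: "0 < side I" "0 < side J" using assms by (auto simp: cubes_def)
  have "cube_vol J \<le> cube_vol I"
    unfolding cube_vol_def using assms s by (intro power_mono) auto
  then have "ec I J = (side J / side I) powr (real CARD('n))"
    using s by (simp add: ec_def cube_vol_def powr_realpow power_divide)
  moreover have "real CARD('n) * (1/2 + \<delta> / real CARD('n)) = real CARD('n) / 2 + \<delta>"
    by (simp add: field_simps)
  ultimately show ?thesis by (simp add: powr_powr)
qed

lemma cube_vol_powr:
  fixes I :: "('n::finite) cube"
  assumes "I \<in> cubes"
  shows "cube_vol I powr a = side I powr (real CARD('n) * a)"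
  using assms by (simp add: cubes_def cube_vol_def powr_realpow[symmetric] powr_powr)

subsection \<open>Smooth cutoff functions\<close>

text \<open>By uniqueness of the derivative, an explicit formula may replace
  \<open>frechet_derivative\<close>.\<close>

lemma C_k_SucI:
  assumes "\<And>x. (f has_derivative f' x) (at x)" "\<And>i. C_k k (\<lambda>x. f' x (axis i 1))"
  shows "C_k (Suc k) f"
proof -
  have "frechet_derivative f (at x) = f' x" for x
    using frechet_derivative_at[OF assms(1)] by simp
  then show ?thesis
    using assms by (auto simp: differentiable_def)
qed

lemma C_k_SucD:
  assumes "C_k (Suc k) f"
  shows "(f has_derivative frechet_derivative f (at x)) (at x)"
    "C_k k (\<lambda>x. frechet_derivative f (at x) (axis i 1))"
  using assms by (auto simp: frechet_derivative_works[symmetric])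

lemma C_k_continuous: "C_k k f \<Longrightarrow> continuous_on UNIV f"
  by (cases k)
    (auto intro!: differentiable_imp_continuous_within continuous_at_imp_continuous_on)

text \<open>Product and chain rule reproduce the undifferentiated function, which the induction then
  needs at the lower order.\<close>

lemma C_k_Suc_imp: "C_k (Suc k) f \<Longrightarrow> C_k k f"
proof (induction k arbitrary: f)
  case 0
  then show ?case using C_k_continuous[of "Suc 0"] by simp
next
  case (Suc k)
  then show ?case
    by (intro C_k_SucI[OF C_k_SucD(1)[OF Suc.prems]] Suc.IH[OF C_k_SucD(2)[OF Suc.prems]])
qed

lemma C_k_const: "C_k k (\<lambda>_. a)"
proof (induction k arbitrary: a)
  case (Suc k)
  then show ?case by (intro C_k_SucI[where f' = "\<lambda>_ _. 0"]) auto
qed auto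

lemma C_k_component: "C_k k (\<lambda>x. x $ i)"
proof (cases k)
  case 0
  then show ?thesis by (auto intro!: continuous_intros)
next
  case (Suc l)
  have "C_k (Suc l) (\<lambda>x. x $ i)"
    by (rule C_k_SucI[OF bounded_linear_imp_has_derivative[OF bounded_linear_vec_nth]])
      (rule C_k_const)
  then show ?thesis using Suc by simp
qed

lemma C_k_add:
  assumes "C_k k f" "C_k k g"
  shows "C_k k (\<lambda>x. f x + g x)"
  using assms
proof (induction k arbitrary: f g)
  case 0
  then show ?case by (auto intro!: continuous_intros)
next
  case (Suc k)
  then show ?case
    by (intro C_k_SucI[OF has_derivative_add[OF C_k_SucD(1) C_k_SucD(1)]] Suc.IH C_k_SucD(2))
qed

lemma C_k_mult:
  assumes "C_k k f" "C_k k g"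
  shows "C_k k (\<lambda>x. f x * g x)"
  using assms
proof (induction k arbitrary: f g)
  case 0
  then show ?case by (auto intro!: continuous_intros)
next
  case (Suc k)
  then show ?case
    by (intro C_k_SucI[OF has_derivative_mult[OF C_k_SucD(1) C_k_SucD(1)]] C_k_add
        Suc.IH[OF C_k_Suc_imp C_k_SucD(2)] Suc.IH[OF C_k_SucD(2) C_k_Suc_imp])
qed

lemma C_k_sum: "(\<And>a. a \<in> A \<Longrightarrow> C_k k (f a)) \<Longrightarrow> C_k k (\<lambda>x. \<Sum>a\<in>A. f a x)"
  by (induction A rule: infinite_finite_induct) (auto intro: C_k_const C_k_add)

lemma C_k_diff: "C_k k f \<Longrightarrow> C_k k g \<Longrightarrow> C_k k (\<lambda>x. f x - g x)"
  using C_k_add[of k f "\<lambda>x. - 1 * g x"] C_k_mult[OF C_k_const, of k g "- 1"] by simp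

text \<open>Taking a whole class \<open>G\<close> closed under differentiation lets the induction on
  \<open>k\<close> pass from \<open>g\<close> to \<open>g'\<close> without naming higher
  derivatives. Derivatives are asked for only at values of \<open>f\<close>, so functions singular
  elsewhere are allowed.\<close>

lemma C_k_compose:
  assumes "\<And>g. g \<in> G \<Longrightarrow> \<exists>g'\<in>G. \<forall>x. (g has_real_derivative g' (f x)) (at (f x))"
    "C_k k f" "g \<in> G"
  shows "C_k k (\<lambda>x. g (f x))"
  using assms(2,3)
proof (induction k arbitrary: g)
  case 0
  obtain g' where "\<And>x. (g has_real_derivative g' (f x)) (at (f x))"
    using assms(1)[OF 0(2)] by blast
  then have "isCont g (f x)" for x by (rule DERIV_isCont)
  moreover have "isCont f x" for x
    using 0(1) by (simp add: continuous_on_eq_continuous_at)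
  ultimately show ?case
    using isCont_o2[where f = f and g = g] by (auto intro!: continuous_at_imp_continuous_on)
next
  case (Suc k)
  obtain g' where g': "g' \<in> G" "\<And>x. (g has_real_derivative g' (f x)) (at (f x))"
    using assms(1)[OF Suc.prems(2)] by blast
  have "((\<lambda>x. g (f x)) has_derivative (\<lambda>h. g' (f x) * frechet_derivative f (at x) h)) (at x)" for x
    by (rule has_derivative_compose[OF C_k_SucD(1)[OF Suc.prems(1)] g'(2)[unfolded has_field_derivative_def]])
  then show ?case
    using Suc.IH[OF C_k_Suc_imp g'(1)] C_k_SucD(2) Suc.prems(1)
    by (intro C_k_SucI[where f' = "\<lambda>x h. g' (f x) * frechet_derivative f (at x) h"] C_k_mult)
qed

text \<open>The polynomial factor makes the class closed under differentiation.\<close>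

definition flat_fun :: "real poly \<Rightarrow> real \<Rightarrow> real" where
  "flat_fun p x = (if 0 < x then poly p (1 / x) * exp (- (1 / x)) else 0)"

text \<open>The free power \<open>y ^ k\<close> is what carries the induction on \<open>p\<close>:
  each coefficient step shifts one factor y into it.\<close>

lemma tendsto_power_poly_exp_0:
  "((\<lambda>y::real. y ^ k * poly p y * exp (- y)) \<longlongrightarrow> 0) at_top"
proof (induction p arbitrary: k)
  case 0
  then show ?case by simp
next
  case (pCons a p)
  have "((\<lambda>y. a * (y ^ k / exp y) + y ^ Suc k * poly p y * exp (- y)) \<longlongrightarrow> a * 0 + 0) at_top"
    by (intro tendsto_intros tendsto_power_div_exp_0 pCons.IH)
  then show ?case by (simp add: exp_minus field_simps)
qed

text \<open>With y = 1/x, differentiating p(y) exp(-y) gives y^2 (p - p')(y) exp(-y), and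
  \<open>[:0, 0, 1:]\<close> is the polynomial y^2.\<close>

lemma flat_fun_has_derivative:
  "(flat_fun p has_real_derivative flat_fun ([:0, 0, 1:] * (p - pderiv p)) x) (at x)"
proof -
  consider "x < 0" | "x = 0" | "x > 0" by linarith
  then show ?thesis
  proof cases
    case 1
    have "((\<lambda>_. 0) has_real_derivative 0) (at x)" by simp
    then have "(flat_fun p has_real_derivative 0) (at x)"
      by (rule has_field_derivative_transform_within_open[of _ _ _ "{..<0}"])
        (use 1 in \<open>auto simp: flat_fun_def\<close>)
    then show ?thesis using 1 by (simp add: flat_fun_def)
  next
    case 2
    \<comment> \<open>At 0 the difference quotient is y p(y) exp(-y) with y = 1/h, the case k = 1 of
      the limit above; from the left it is identically 0.\<close>
    have "((\<lambda>h. flat_fun p h / h) \<longlongrightarrow> 0) (at_right 0)"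
    proof -
      have "((\<lambda>h. inverse h ^ 1 * poly p (inverse h) * exp (- inverse h)) \<longlongrightarrow> 0) (at_right (0::real))"
        by (rule filterlim_compose[OF tendsto_power_poly_exp_0 filterlim_inverse_at_top_right])
      then show ?thesis
        by (rule Lim_transform_eventually)
          (auto simp: eventually_at_right_less flat_fun_def field_simps
            intro!: eventually_mono[OF eventually_at_right_less])
    qed
    moreover have "((\<lambda>h. flat_fun p h / h) \<longlongrightarrow> 0) (at_left 0)"
      by (rule Lim_transform_eventually[OF tendsto_const])
        (auto simp: flat_fun_def eventually_at_filter)
    ultimately show ?thesis
      using 2 by (simp add: DERIV_def filterlim_split_at flat_fun_def[of _ 0])
  next
    case 3
    have "((\<lambda>x. poly p (1 / x) * exp (- (1 / x))) has_real_derivative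
        flat_fun ([:0, 0, 1:] * (p - pderiv p)) x) (at x)"
      using 3 by (auto intro!: derivative_eq_intros DERIV_chain2[OF poly_DERIV]
          simp: flat_fun_def field_simps power2_eq_square)
    then show ?thesis
      by (rule has_field_derivative_transform_within_open[of _ _ _ "{0<..}"])
        (use 3 in \<open>auto simp: flat_fun_def\<close>)
  qed
qed

lemma C_k_flat_fun: "C_k k f \<Longrightarrow> C_k k (\<lambda>x. flat_fun p (f x))"
  by (rule C_k_compose[where G = "range flat_fun" and g = "flat_fun p"])
    (auto intro: flat_fun_has_derivative)

text \<open>The multiples of negative powers form a class closed under differentiation away from 0;
  \<open>inverse\<close> is its member with c = m = 1.\<close>

lemma C_k_inverse:
  assumes "C_k k f" "\<And>x. f x \<noteq> 0"
  shows "C_k k (\<lambda>x. inverse (f x))"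
proof (rule C_k_compose[where G = "range (\<lambda>(c, m) y. c * inverse y ^ m)", OF _ assms(1)])
  show "inverse \<in> range (\<lambda>(c::real, m) y. c * inverse y ^ m)"
    by (rule image_eqI[of _ _ "(1, 1)"]) auto
next
  fix g assume "g \<in> range (\<lambda>(c::real, m) y. c * inverse y ^ m)"
  then obtain c m where g: "g = (\<lambda>y. c * inverse y ^ m)" by auto
  have "(g has_real_derivative (- c * m) * inverse (f x) ^ Suc m) (at (f x))" for x
  proof -
    have "(g has_real_derivative c * (real m * inverse (f x) ^ (m - Suc 0) * (- (inverse (f x) * inverse (f x))))) (at (f x))"
      unfolding g using assms(2)[of x] by (auto intro!: derivative_eq_intros)
    also have "c * (real m * inverse (f x) ^ (m - Suc 0) * (- (inverse (f x) * inverse (f x))))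
        = (- c * m) * inverse (f x) ^ Suc m"
      by (cases m) auto
    finally show ?thesis .
  qed
  then show "\<exists>g'\<in>range (\<lambda>(c::real, m) y. c * inverse y ^ m).
      \<forall>x. (g has_real_derivative g' (f x)) (at (f x))"
    by (intro bexI[of _ "\<lambda>y. (- c * m) * inverse y ^ Suc m"] allI image_eqI[of _ _ "(- c * m, Suc m)"])
      auto
qed

text \<open>The max norm is not smooth, so the cutoff is a function of q = |t-c|^2 / r^2 in the
  Euclidean norm. Here \<open>u\<close> vanishes exactly for q \<ge> 2n and \<open>v\<close> exactly
  for q \<le> n, so u/(u+v) is 0 and 1 there, and u+v never vanishes. In max norm, |t-c| \<le> r
  gives q \<le> n, and |t-c| > 2nr gives q \<ge> 4n^2 \<ge> 2n; this is the origin of the radius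
  2nr.\<close>

lemma smooth_cutoff:
  fixes c :: "real^'n"
  assumes "0 < r"
  obtains \<Phi> where "smooth \<Phi>" "\<And>t. 0 \<le> \<Phi> t \<and> \<Phi> t \<le> 1"
    "\<And>t. infnorm (t - c) \<le> r \<Longrightarrow> \<Phi> t = 1"
    "\<And>t. 2 * real CARD('n) * r < infnorm (t - c) \<Longrightarrow> \<Phi> t = 0"
proof -
  define n where "n = real CARD('n)"
  have n: "1 \<le> n" by (simp add: n_def Suc_leI)
  define q where "q t = (\<Sum>i\<in>UNIV. (1 / r * (t $ i - c $ i)) * (1 / r * (t $ i - c $ i)))" for t
  define u where "u t = flat_fun 1 (2 * n - q t)" for t
  define v where "v t = flat_fun 1 (q t - n)" for t
  have nonneg: "0 \<le> u t" "0 \<le> v t" for t by (auto simp: u_def v_def flat_fun_def)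
  have pos: "u t > 0" if "q t < 2 * n" for t using that by (auto simp: u_def flat_fun_def)
  have pos': "v t > 0" if "q t > n" for t using that by (auto simp: v_def flat_fun_def)
  have nz: "u t + v t > 0" for t
    using nonneg[of t] pos[of t] pos'[of t] n by (cases "q t < 2 * n") (force intro: add_pos_nonneg add_nonneg_pos)+
  have q: "C_k k q" for k
    unfolding q_def by (intro C_k_sum C_k_mult C_k_diff C_k_const C_k_component)
  show ?thesis
  proof (rule that[of "\<lambda>t. u t * inverse (u t + v t)"])
    show "smooth (\<lambda>t. u t * inverse (u t + v t))"
      unfolding smooth_def u_def v_def
      using nz by (intro allI C_k_mult C_k_inverse C_k_add C_k_flat_fun C_k_diff C_k_const q)
        (auto simp: u_def v_def less_le)
    show "0 \<le> u t * inverse (u t + v t) \<and> u t * inverse (u t + v t) \<le> 1" for t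
      using nonneg[of t] nz[of t] by (simp add: divide_inverse[symmetric])
    show "u t * inverse (u t + v t) = 1" if "infnorm (t - c) \<le> r" for t
    proof -
      have "(1 / r * (t $ i - c $ i)) * (1 / r * (t $ i - c $ i)) \<le> 1" for i
      proof -
        have "\<bar>t $ i - c $ i\<bar> \<le> r" using that by (auto simp: infnorm_le_iff_cart)
        then have "\<bar>1 / r * (t $ i - c $ i)\<bar> \<le> 1" using assms by (simp add: abs_mult)
        then show ?thesis by (metis abs_square_le_1 power2_eq_square)
      qed
      then have "q t \<le> (\<Sum>i\<in>(UNIV::'n set). 1)" unfolding q_def by (intro sum_mono)
      then have "v t = 0" by (simp add: v_def flat_fun_def n_def)
      then show ?thesis using nz[of t] by simp
    qed
    show "u t * inverse (u t + v t) = 0" if far: "2 * real CARD('n) * r < infnorm (t - c)" for t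
    proof -
      obtain i where "2 * n * r < \<bar>(t - c) $ i\<bar>"
        using far infnorm_le_iff_cart[of "t - c" "2 * n * r"] unfolding n_def by (meson not_le)
      then have "2 * n \<le> \<bar>1 / r * (t $ i - c $ i)\<bar>"
        using assms by (simp add: abs_mult pos_le_divide_eq)
      then have "(2 * n) * (2 * n) \<le> \<bar>1 / r * (t $ i - c $ i)\<bar> * \<bar>1 / r * (t $ i - c $ i)\<bar>"
        using n by (intro mult_mono) auto
      also have "\<dots> = (1 / r * (t $ i - c $ i)) * (1 / r * (t $ i - c $ i))" by (rule abs_mult_self_eq)
      also have "\<dots> \<le> q t" unfolding q_def by (rule member_le_sum) auto
      finally have "2 * n \<le> q t" using n mult_mono[of 1 "2 * n" "2 * n" "2 * n"] by linarith
      then show ?thesis by (simp add: u_def flat_fun_def)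
    qed
  qed
qed

subsection \<open>Kernel regularity\<close>

lemma admissible_functionsD:
  assumes "admissible_functions L S D"
  shows "0 \<le> y \<Longrightarrow> 0 \<le> L y" "0 \<le> y \<Longrightarrow> 0 \<le> S y" "0 \<le> y \<Longrightarrow> 0 \<le> D y"
    "0 \<le> y \<Longrightarrow> y \<le> z \<Longrightarrow> L z \<le> L y" "0 \<le> y \<Longrightarrow> y \<le> z \<Longrightarrow> S y \<le> S z"
    "0 \<le> y \<Longrightarrow> y \<le> z \<Longrightarrow> D z \<le> D y"
  using assms unfolding admissible_functions_def
  by (auto simp: monotone_on_def)

text \<open>\<open>B\<close> is a parameter and not existentially bound, so that later estimates can
  display how they depend on it.\<close>

definition kernel_regularity ::
    "(real^('n::finite) \<Rightarrow> real^'n \<Rightarrow> complex) \<Rightarrow> real \<Rightarrow>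
     (real \<Rightarrow> real) \<Rightarrow> (real \<Rightarrow> real) \<Rightarrow> (real \<Rightarrow> real) \<Rightarrow> real \<Rightarrow> bool" where
  "kernel_regularity K \<delta> L S D B \<longleftrightarrow>
     admissible_functions L S D \<and> 0 < B \<and>
     (\<forall>t x t' x'. 2 * (infnorm (t - t') + infnorm (x - x')) < infnorm (t - x) \<longrightarrow>
          cmod (K t x - K t' x')
            \<le> B * ((infnorm (t - t') + infnorm (x - x')) powr \<delta>
                     / infnorm (t - x) powr (real CARD('n) + \<delta>))
               * L (infnorm (t - x)) * S (infnorm (t - t') + infnorm (x - x'))
               * D (1 + infnorm (t + x) / (1 + infnorm (t - x))))"

lemma kernel_regularityD:
  fixes K :: "real^('n::finite) \<Rightarrow> real^'n \<Rightarrow> complex"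
  assumes "kernel_regularity K \<delta> L S D B"
  shows "admissible_functions L S D" "0 < B"
    "2 * (infnorm (t - t') + infnorm (x - x')) < infnorm (t - x) \<Longrightarrow>
          cmod (K t x - K t' x')
            \<le> B * ((infnorm (t - t') + infnorm (x - x')) powr \<delta>
                     / infnorm (t - x) powr (real CARD('n) + \<delta>))
               * L (infnorm (t - x)) * S (infnorm (t - t') + infnorm (x - x'))
               * D (1 + infnorm (t + x) / (1 + infnorm (t - x)))"
  using assms unfolding kernel_regularity_def by blast+

lemma compact_CZ_kernel_regularity:
  assumes "compact_CZ_kernel K \<delta> L S D"
  obtains B where "kernel_regularity K \<delta> L S D B"
  using assms unfolding compact_CZ_kernel_def kernel_regularity_def by blast

text \<open>Every quantity in the definition is symmetric in the two variables; this makes the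
  adjoint eligible for the same estimates.\<close>

lemma compact_CZ_kernel_swap:
  assumes "compact_CZ_kernel K \<delta> L S D"
  shows "compact_CZ_kernel (\<lambda>x t. K t x) \<delta> L S D"
proof -
  obtain B where adm: "admissible_functions L S D" and "B > 0"
    and reg: "\<And>t x t' x'. 2 * (infnorm (t - t') + infnorm (x - x')) < infnorm (t - x) \<Longrightarrow>
          cmod (K t x - K t' x')
            \<le> B * ((infnorm (t - t') + infnorm (x - x')) powr \<delta>
                     / infnorm (t - x) powr (real CARD('a) + \<delta>))
               * L (infnorm (t - x)) * S (infnorm (t - t') + infnorm (x - x'))
               * D (1 + infnorm (t + x) / (1 + infnorm (t - x)))"
    and size: "\<And>t x. t \<noteq> x \<Longrightarrow> cmod (K t x)
            \<le> B * (1 / infnorm (t - x) ^ CARD('a))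
               * L (infnorm (t - x)) * S (infnorm (t - x))
               * D (1 + infnorm (t + x) / (1 + infnorm (t - x)))"
    using assms unfolding compact_CZ_kernel_def by blast
  show ?thesis
    unfolding compact_CZ_kernel_def
  proof (intro conjI exI[of _ B] adm \<open>B > 0\<close> allI impI)
    fix t x t' x' :: "real^'a"
    assume "2 * (infnorm (t - t') + infnorm (x - x')) < infnorm (t - x)"
    then show "cmod (K x t - K x' t')
            \<le> B * ((infnorm (t - t') + infnorm (x - x')) powr \<delta>
                     / infnorm (t - x) powr (real CARD('a) + \<delta>))
               * L (infnorm (t - x)) * S (infnorm (t - t') + infnorm (x - x'))
               * D (1 + infnorm (t + x) / (1 + infnorm (t - x)))"
      using reg[where t = x and x = t and t' = x' and x' = t'] infnorm_sub[of t x] by (simp add: add.commute)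
  next
    fix t x :: "real^'a" assume "t \<noteq> x"
    then show "cmod (K x t)
            \<le> B * (1 / infnorm (t - x) ^ CARD('a))
               * L (infnorm (t - x)) * S (infnorm (t - x))
               * D (1 + infnorm (t + x) / (1 + infnorm (t - x)))"
      using size[where t = x and x = t] infnorm_sub[of t x] by (simp add: add.commute)
  qed
qed

text \<open>Regularity is used with the limit point as base point, so all factors are constants
  except S(d), which is bounded, and d^\<delta>, which tends to 0. Continuity off the diagonal then
  supplies measurability and integrability of the integrands.\<close>

lemma continuous_on_kernel:
  fixes K :: "real^('n::finite) \<Rightarrow> real^'n \<Rightarrow> complex"
  assumes reg: "kernel_regularity K \<delta> L S D B" and "0 < \<delta>"
  shows "continuous_on {z. fst z \<noteq> snd z} (\<lambda>(x, t). K x t)"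
proof (rule continuous_at_imp_continuous_on, rule ballI)
  fix z0 :: "(real^'n) \<times> (real^'n)" assume z0: "z0 \<in> {z. fst z \<noteq> snd z}"
  obtain x0 t0 where z0_eq: "z0 = (x0, t0)" by (cases z0)
  define d where "d z = infnorm (x0 - fst z) + infnorm (t0 - snd z)" for z
  have adm: "admissible_functions L S D" using reg by (simp add: kernel_regularity_def)
  obtain S1 where S1: "\<And>y. 0 \<le> y \<Longrightarrow> S y \<le> S1"
    using adm unfolding admissible_functions_def bounded_iff by (auto simp: abs_le_iff)
  define a where "a = B * (1 / infnorm (x0 - t0) powr (real CARD('n) + \<delta>)) * L (infnorm (x0 - t0))"
  define b where "b = D (1 + infnorm (x0 + t0) / (1 + infnorm (x0 - t0)))"
  have nonneg: "0 \<le> a" "0 \<le> b"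
    unfolding a_def b_def using reg
    by (auto simp: kernel_regularity_def infnorm_pos_le admissible_functionsD[OF adm])
  have d: "(d \<longlongrightarrow> 0) (at z0)"
  proof -
    have "(d \<longlongrightarrow> infnorm (x0 - fst z0) + infnorm (t0 - snd z0)) (at z0)"
      unfolding d_def by (intro tendsto_intros)
    then show ?thesis by (simp add: z0_eq infnorm_0)
  qed
  have d0: "0 \<le> d z" for z by (simp add: d_def infnorm_pos_le)
  have pos: "0 < infnorm (x0 - t0)" using z0 z0_eq by (simp add: infnorm_pos_lt)
  have "\<forall>\<^sub>F z in at z0. d z < infnorm (x0 - t0) / 2"
    using d pos by (intro order_tendstoD) auto
  then have "\<forall>\<^sub>F z in at z0. norm ((case z of (x, t) \<Rightarrow> K x t) - K x0 t0) \<le> a * S1 * b * d z powr \<delta>"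
  proof eventually_elim
    case (elim z)
    have "norm ((case z of (x, t) \<Rightarrow> K x t) - K x0 t0) = norm (K x0 t0 - K (fst z) (snd z))"
      by (simp add: norm_minus_commute case_prod_beta)
    also have "\<dots> \<le> B * (d z powr \<delta> / infnorm (x0 - t0) powr (real CARD('n) + \<delta>))
        * L (infnorm (x0 - t0)) * S (d z) * D (1 + infnorm (x0 + t0) / (1 + infnorm (x0 - t0)))"
      unfolding d_def by (rule kernel_regularityD(3)[OF reg]) (use elim in \<open>simp add: d_def\<close>)
    also have "\<dots> = (a * d z powr \<delta>) * S (d z) * b"
      by (simp add: a_def b_def)
    also have "\<dots> \<le> (a * d z powr \<delta>) * S1 * b"
      using nonneg S1[OF d0] by (intro mult_right_mono mult_left_mono) auto
    finally show ?case by (simp add: mult_ac)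
  qed
  moreover have "((\<lambda>z. a * S1 * b * d z powr \<delta>) \<longlongrightarrow> 0) (at z0)"
    using d d0 \<open>0 < \<delta>\<close> by (intro tendsto_mult_right_zero tendsto_zero_powrI) auto
  ultimately have "((\<lambda>z. (case z of (x, t) \<Rightarrow> K x t) - K x0 t0) \<longlongrightarrow> 0) (at z0)"
    by (rule Lim_null_comparison)
  then show "isCont (\<lambda>(x, t). K x t) z0"
    unfolding isCont_def z0_eq by (simp add: LIM_zero_iff)
qed

text \<open>The base point is (c(J), t) rather than (x, t), so the bound is independent of
  \<open>x\<close> and the integration over \<open>J\<close> only contributes |J|. Since |x - c(J)|
  \<le> l(J)/2, the condition on \<open>t\<close> is what regularity requires.\<close>

lemma kernel_difference_bound:
  fixes K :: "real^('n::finite) \<Rightarrow> real^'n \<Rightarrow> complex"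
  assumes reg: "kernel_regularity K \<delta> L S D B" and "0 < \<delta>" "J \<in> cubes" "x \<in> cube_set J"
    and far: "side J < infnorm (center J - t)"
  shows "cmod (K x t - K (center J) t)
    \<le> B * side J powr \<delta> * S (side J) / infnorm (center J - t) powr (real CARD('n) + \<delta>)
      * L (infnorm (center J - t))
      * D (1 + infnorm (center J + t) / (1 + infnorm (center J - t)))"
proof -
  have adm: "admissible_functions L S D" and "0 < B"
    using reg by (auto simp: kernel_regularity_def)
  have s: "0 < side J" using assms by (simp add: cubes_def)
  have d: "infnorm (center J - x) \<le> side J / 2" "0 \<le> infnorm (center J - x)"
    using assms(4) infnorm_sub[of x "center J"] by (auto simp: mem_cube_set infnorm_pos_le)
  have "cmod (K x t - K (center J) t) = cmod (K (center J) t - K x t)" by (rule norm_minus_commute)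
  also have "\<dots> \<le> B * (infnorm (center J - x) powr \<delta> / infnorm (center J - t) powr (real CARD('n) + \<delta>))
      * L (infnorm (center J - t)) * S (infnorm (center J - x))
      * D (1 + infnorm (center J + t) / (1 + infnorm (center J - t)))"
    using kernel_regularityD(3)[OF reg, of "center J" x t t] d far by (simp add: infnorm_0)
  also have "\<dots> \<le> B * (side J powr \<delta> / infnorm (center J - t) powr (real CARD('n) + \<delta>))
      * L (infnorm (center J - t)) * S (side J)
      * D (1 + infnorm (center J + t) / (1 + infnorm (center J - t)))"
    using d s \<open>0 < B\<close> \<open>0 < \<delta>\<close>
    by (intro mult_mono divide_right_mono powr_mono2 mult_nonneg_nonneg admissible_functionsD[OF adm])
      (auto simp: infnorm_pos_le)
  finally show ?thesis by (simp add: mult_ac)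
qed

subsection \<open>Pairings of functions with disjoint supports\<close>

lemma in_supp: "f x \<noteq> 0 \<Longrightarrow> x \<in> supp f"
  unfolding supp_def using closure_subset[of "{x. f x \<noteq> 0}"] by auto

lemma supp_subset_closed: "closed A \<Longrightarrow> (\<And>x. f x \<noteq> 0 \<Longrightarrow> x \<in> A) \<Longrightarrow> supp f \<subseteq> A"
  unfolding supp_def by (rule closure_minimal) auto

lemma C0_of_compact: "continuous_on UNIV f \<Longrightarrow> compact A \<Longrightarrow> supp f \<subseteq> A \<Longrightarrow> f \<in> C0"
  using compact_Int_closed[of A "supp f"] by (simp add: C0_def supp_def inf.absorb2)

lemma integrable_of_compact_support:
  fixes h :: "(real^'n) \<times> (real^'n) \<Rightarrow> complex"
  assumes "compact A" "continuous_on A h" "\<And>z. z \<notin> A \<Longrightarrow> h z = 0"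
  shows "integrable (lborel \<Otimes>\<^sub>M lborel) h"
proof -
  have "(\<lambda>z. indicator A z *\<^sub>R h z) = h"
    using assms(3) by (auto simp: indicator_def)
  then show ?thesis
    using borel_integrable_compact[OF assms(1,2)] by (simp add: lborel_prod)
qed

lemma C0_mult_integrable:
  fixes f g :: "real^'n \<Rightarrow> complex"
  assumes "f \<in> C0" "g \<in> C0" "continuous_on (supp g \<times> supp f) (\<lambda>(x, t). h x t)"
  shows "integrable (lborel \<Otimes>\<^sub>M lborel) (\<lambda>(x, t). f t * g x * h x t)"
proof (rule integrable_of_compact_support)
  have "continuous_on (supp g \<times> supp f) (\<lambda>z. f (snd z))" "continuous_on (supp g \<times> supp f) (\<lambda>z. g (fst z))"
    using assms(1,2) unfolding C0_def
    by (auto intro!: continuous_on_compose2[of UNIV _ _ snd] continuous_on_compose2[of UNIV _ _ fst] continuous_intros)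
  then show "continuous_on (supp g \<times> supp f) (\<lambda>(x, t). f t * g x * h x t)"
    using assms(3) by (auto simp: case_prod_beta intro!: continuous_intros)
  show "compact (supp g \<times> supp f)"
    using assms by (auto simp: C0_def intro: compact_Times)
qed (auto intro: in_supp)

text \<open>The product of disjoint compact supports is a compact set off the diagonal, where the
  kernel is continuous; hence Fubini turns the iterated integral into a product integral.\<close>

lemma associated_with_pairing:
  fixes K :: "real^('n::finite) \<Rightarrow> real^'n \<Rightarrow> complex"
  assumes "associated_with T K" "continuous_on {z. fst z \<noteq> snd z} (\<lambda>(x, t). K x t)"
    and fg: "f \<in> C0" "g \<in> C0" "supp f \<inter> supp g = {}"
  shows "integrable (lborel \<Otimes>\<^sub>M lborel) (\<lambda>(x, t). f t * g x * K x t)"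
    "T f g = (\<integral>(x, t). f t * g x * K x t \<partial>(lborel \<Otimes>\<^sub>M lborel))"
proof -
  show int: "integrable (lborel \<Otimes>\<^sub>M lborel) (\<lambda>(x, t). f t * g x * K x t)"
    using fg(3) by (intro C0_mult_integrable fg continuous_on_subset[OF assms(2)]) auto
  show "T f g = (\<integral>(x, t). f t * g x * K x t \<partial>(lborel \<Otimes>\<^sub>M lborel))"
    using assms(1) fg lborel_pair.integral_fst'[OF int] unfolding associated_with_def by simp
qed

text \<open>\<open>associated_with\<close> fixes an order of integration, so exchanging the
  arguments requires Fubini.\<close>

lemma associated_with_adjoint:
  fixes K :: "real^('n::finite) \<Rightarrow> real^'n \<Rightarrow> complex"
  assumes "associated_with T K" "continuous_on {z. fst z \<noteq> snd z} (\<lambda>(x, t). K x t)"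
  shows "associated_with (adjoint_operator T) (\<lambda>x t. K t x)"
  unfolding associated_with_def adjoint_operator_def
proof (intro ballI impI)
  fix f g :: "real^'n \<Rightarrow> complex" assume fg: "f \<in> C0" "g \<in> C0" "supp f \<inter> supp g = {}"
  then have "supp g \<inter> supp f = {}" by auto
  note * = associated_with_pairing[OF assms fg(2,1) this]
  have "T g f = (LINT t|lborel. LINT x|lborel. g x * f t * K t x)"
    using assms(1) fg \<open>supp g \<inter> supp f = {}\<close> unfolding associated_with_def by simp
  also have "\<dots> = (LINT x|lborel. LINT t|lborel. g x * f t * K t x)"
    by (rule lborel_pair.Fubini_integral[symmetric]) (rule *(1))
  finally show "T g f = (LINT x|lborel. LINT t|lborel. f t * g x * K t x)"
    by (simp add: mult_ac)
qed

text \<open>The subtracted term factors with the integral of \<open>g\<close>, which is zero. The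
  condition on \<open>c\<close> keeps K(c,t) continuous on the support of \<open>f\<close>, so this
  term is integrable by itself.\<close>

lemma pairing_kernel_difference:
  fixes K :: "real^('n::finite) \<Rightarrow> real^'n \<Rightarrow> complex"
  assumes "associated_with T K" and K: "continuous_on {z. fst z \<noteq> snd z} (\<lambda>(x, t). K x t)"
    and fg: "f \<in> C0" "g \<in> C0" "supp f \<inter> supp g = {}" and c: "c \<notin> supp f"
    and zero: "integral\<^sup>L lborel g = 0"
  shows "integrable (lborel \<Otimes>\<^sub>M lborel) (\<lambda>(x, t). f t * g x * (K x t - K c t))" (is ?int)
    "T f g = (\<integral>(x, t). f t * g x * (K x t - K c t) \<partial>(lborel \<Otimes>\<^sub>M lborel))" (is ?eq)
proof -
  note * = associated_with_pairing[OF assms(1) K fg]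
  have "continuous_on (supp g \<times> supp f) (\<lambda>z. (\<lambda>(x, t). K x t) (c, snd z))"
    by (rule continuous_on_compose2[OF K]) (use c in \<open>auto intro!: continuous_intros\<close>)
  then have int: "integrable (lborel \<Otimes>\<^sub>M lborel) (\<lambda>(x, t). f t * g x * K c t)"
    by (intro C0_mult_integrable fg) (simp add: case_prod_beta)
  have "(\<integral>(x, t). f t * g x * K c t \<partial>(lborel \<Otimes>\<^sub>M lborel)) = (LINT x|lborel. LINT t|lborel. f t * g x * K c t)"
    using lborel_pair.integral_fst'[OF int] by simp
  also have "\<dots> = (LINT x|lborel. g x * (LINT t|lborel. f t * K c t))"
    by (subst integral_mult_right_zero[symmetric]) (simp add: mult_ac)
  also have "\<dots> = 0" using zero by simp
  finally have 0: "(\<integral>(x, t). f t * g x * K c t \<partial>(lborel \<Otimes>\<^sub>M lborel)) = 0" .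
  have eq: "(\<lambda>(x, t). f t * g x * (K x t - K c t))
      = (\<lambda>z. (\<lambda>(x, t). f t * g x * K x t) z - (\<lambda>(x, t). f t * g x * K c t) z)"
    by (auto simp: algebra_simps)
  show ?int unfolding eq using *(1) int by (rule Bochner_Integration.integrable_diff)
  show ?eq unfolding eq using *(2) 0
    by (subst Bochner_Integration.integral_diff[OF *(1) int]) simp
qed

text \<open>Tonelli for a majorant that is a product in the two variables. \<open>G\<close> takes
  values in the extended nonnegative reals, so that a series of ball indicators can serve as
  majorant without prior convergence.\<close>

lemma product_integral_bound:
  fixes E :: "(real^'n) \<times> (real^'n) \<Rightarrow> complex"
  assumes [measurable]: "E \<in> borel_measurable (lborel \<Otimes>\<^sub>M lborel)" "Q \<in> sets borel" "G \<in> borel_measurable borel"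
    and E: "\<And>x t. ennreal (norm (E (x, t))) \<le> indicator Q x * G t"
    and q: "emeasure lborel Q = ennreal q" "0 \<le> q" and b: "(\<integral>\<^sup>+t. G t \<partial>lborel) \<le> ennreal b" "0 \<le> b"
  shows "integrable (lborel \<Otimes>\<^sub>M lborel) E" "norm (integral\<^sup>L (lborel \<Otimes>\<^sub>M lborel) E) \<le> q * b"
proof -
  have "(\<integral>\<^sup>+z. norm (E z) \<partial>(lborel \<Otimes>\<^sub>M lborel)) = (\<integral>\<^sup>+x. \<integral>\<^sup>+t. norm (E (x, t)) \<partial>lborel \<partial>lborel)"
    by (rule lborel.nn_integral_fst[symmetric]) simp
  also have "\<dots> \<le> (\<integral>\<^sup>+x. \<integral>\<^sup>+t. indicator Q x * G t \<partial>lborel \<partial>lborel)"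
    using E by (intro nn_integral_mono) auto
  also have "\<dots> = (\<integral>\<^sup>+x. (\<integral>\<^sup>+t. G t \<partial>lborel) * indicator Q x \<partial>lborel)"
    by (subst nn_integral_cmult) (auto simp: mult.commute)
  also have "\<dots> = (\<integral>\<^sup>+t. G t \<partial>lborel) * ennreal q"
    by (subst nn_integral_cmult_indicator) (auto simp: q)
  also have "\<dots> \<le> ennreal b * ennreal q"
    using b by (intro mult_right_mono) auto
  also have "\<dots> = ennreal (q * b)" using b q by (simp add: ennreal_mult mult.commute)
  finally have *: "(\<integral>\<^sup>+z. norm (E z) \<partial>(lborel \<Otimes>\<^sub>M lborel)) \<le> ennreal (q * b)" .
  show int: "integrable (lborel \<Otimes>\<^sub>M lborel) E"
    by (rule integrableI_bounded) (use * in \<open>auto intro: le_less_trans\<close>)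
  have "ennreal (norm (integral\<^sup>L (lborel \<Otimes>\<^sub>M lborel) E)) \<le> ennreal (q * b)"
    using integral_norm_bound_ennreal[OF int] * by (rule order_trans)
  then show "norm (integral\<^sup>L (lborel \<Otimes>\<^sub>M lborel) E) \<le> q * b"
    using b q by (simp add: ennreal_le_iff)
qed

subsection \<open>Bump functions\<close>

lemma decay_le_1:
  assumes "I \<in> cubes"
  shows "(1 + infnorm (x - center I) / side I) powr (- real N) \<le> 1"
proof -
  have "1 \<le> 1 + infnorm (x - center I) / side I"
    using assms by (simp add: cubes_def infnorm_pos_le)
  then show ?thesis
    using powr_mono[of "- real N" 0 "1 + infnorm (x - center I) / side I"] by simp
qed

lemma bump_order0_le:
  assumes "bump_order0 I C N \<phi>" "I \<in> cubes" "0 < C"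
  shows "cmod (\<phi> x) \<le> C * cube_vol I powr (-1/2)"
proof -
  have "cmod (\<phi> x) \<le> C * cube_vol I powr (-1/2) * (1 + infnorm (x - center I) / side I) powr (- real N)"
    using assms(1) by (simp add: bump_order0_def)
  also have "\<dots> \<le> C * cube_vol I powr (-1/2) * 1"
    using assms(3) decay_le_1[OF assms(2)] by (intro mult_left_mono) auto
  finally show ?thesis by simp
qed

lemma bump_order1_diff_le:
  assumes "bump_order1 I C N \<alpha> \<phi>" "I \<in> cubes" "0 < C"
  shows "cmod (\<phi> t - \<phi> x) \<le> C * cube_vol I powr (-1/2) * (infnorm (t - x) / side I) powr \<alpha>"
proof -
  let ?S = "cube_set (smallest_cube {t, x})"
  \<comment> \<open>The supremum is taken in a conditionally complete order, so bounding it by 1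
    needs a nonempty index set.\<close>
  have "{t, x} \<subseteq> ?S"
    using is_smallest_cube_smallest_cube[of "{t, x}"] by (simp add: is_smallest_cube_def)
  then have "?S \<noteq> {}" by auto
  then have sup: "(SUP r \<in> ?S. (1 + infnorm (r - center I) / side I) powr (- real N)) \<le> 1"
    by (intro cSUP_least decay_le_1 assms(2))
  have "cmod (\<phi> t - \<phi> x)
        \<le> C * (infnorm (t - x) / side I) powr \<alpha> * cube_vol I powr (-1/2)
           * (SUP r \<in> ?S. (1 + infnorm (r - center I) / side I) powr (- real N))"
    using assms(1) by (simp add: bump_order1_def)
  also have "\<dots> \<le> C * (infnorm (t - x) / side I) powr \<alpha> * cube_vol I powr (-1/2) * 1"
    using assms(3) sup by (intro mult_left_mono) auto
  finally show ?thesis by (simp add: mult_ac)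
qed

subsection \<open>Dyadic decompositions\<close>

lemma dyadic_scale:
  assumes "1 \<le> (y::real)"
  obtains j where "2 ^ j \<le> y" "y < 2 ^ Suc j"
proof -
  obtain m where m: "y < 2 ^ m" using real_arch_pow[of 2 y] by auto
  define k where "k = (LEAST m. y < 2 ^ m)"
  have k: "y < 2 ^ k" unfolding k_def using m by (rule LeastI)
  with assms have "k \<noteq> 0" by (intro notI) simp
  then obtain j where j: "k = Suc j" by (cases k) auto
  then have "\<not> y < 2 ^ j" unfolding k_def by (intro not_less_Least) simp
  then show ?thesis using that[of j] k j by simp
qed

lemma dyadic_scale':
  assumes "1 < (y::real)"
  obtains j where "2 ^ j < y" "y \<le> 2 ^ Suc j"
proof -
  obtain m where "y < 2 ^ m" using real_arch_pow[of 2 y] by auto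
  then have m: "y \<le> 2 ^ m" by simp
  define k where "k = (LEAST m. y \<le> 2 ^ m)"
  have k: "y \<le> 2 ^ k" unfolding k_def using m by (rule LeastI)
  with assms have "k \<noteq> 0" by (intro notI) simp
  then obtain j where j: "k = Suc j" by (cases k) auto
  then have "\<not> y \<le> 2 ^ j" unfolding k_def by (intro not_less_Least) simp
  then show ?thesis using that[of j] k j by simp
qed

lemma infnorm_cball_borel [measurable]: "{t. infnorm (t - c :: real^'n) \<le> r} \<in> sets borel"
  unfolding infnorm_cball_eq_cbox by simp

text \<open>Annuli will be enlarged to the balls containing them: this costs only a constant, and a
  ball of radius r has volume (2r)^n.\<close>

lemma nn_integral_infnorm_cballs:
  fixes c :: "real^'n"
  assumes "\<And>j. 0 \<le> a j" "\<And>j. 0 \<le> r j" "(\<lambda>j. a j * (2 * r j) ^ CARD('n)) sums s"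
  shows "(\<integral>\<^sup>+t. (\<Sum>j. ennreal (a j) * indicator {t. infnorm (t - c) \<le> r j} t) \<partial>lborel) = ennreal s"
proof -
  have "(\<integral>\<^sup>+t. (\<Sum>j. ennreal (a j) * indicator {t. infnorm (t - c) \<le> r j} t) \<partial>lborel)
      = (\<Sum>j. \<integral>\<^sup>+t. ennreal (a j) * indicator {t. infnorm (t - c) \<le> r j} t \<partial>lborel)"
    using infnorm_cball_borel by (intro nn_integral_suminf) auto
  also have "\<dots> = (\<Sum>j. ennreal (a j * (2 * r j) ^ CARD('n)))"
    using infnorm_cball_borel assms(1,2)
    by (intro arg_cong[where f = suminf] ext)
      (simp add: nn_integral_cmult_indicator emeasure_infnorm_cball ennreal_mult)
  also have "\<dots> = ennreal s"
    using assms by (subst suminf_ennreal2) (auto simp: sums_iff)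
  finally show ?thesis .
qed

text \<open>Hoelder gain times kernel size times ball volume at radius 2^(-j) l. The exponent of 2^j
  is -\<alpha> + (n+\<delta>) - n = \<delta> - \<alpha>.\<close>

lemma near_scale_identity:
  fixes l :: real
  assumes "0 < l"
  shows "(1 / 2 ^ j) powr \<alpha> * (2 ^ Suc j / l) powr (real n + \<delta>) * (2 * (l / 2 ^ j)) ^ n
    = 2 powr (2 * real n + \<delta>) * l powr (- \<delta>) * (2 powr (\<delta> - \<alpha>)) ^ j"
proof -
  have 1: "(1 / 2 ^ j) powr \<alpha> = 2 powr (- (real j * \<alpha>))"
    by (simp add: powr_realpow[symmetric] powr_minus_divide[symmetric] powr_powr)
  have 2: "(2 ^ Suc j / l) powr (real n + \<delta>) = 2 powr ((real j + 1) * (real n + \<delta>)) * l powr (- (real n + \<delta>))"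
  proof -
    have "(2 ^ Suc j / l) powr (real n + \<delta>) = (2 powr (real j + 1)) powr (real n + \<delta>) / l powr (real n + \<delta>)"
      using assms powr_realpow[of 2 "Suc j"] by (simp add: powr_divide add.commute)
    then show ?thesis unfolding powr_powr powr_minus divide_inverse .
  qed
  have 3: "(2 * (l / 2 ^ j)) ^ n = 2 powr (real n - real j * real n) * l powr real n"
    using assms by (simp add: power_mult_distrib power_divide power_mult[symmetric] powr_realpow[symmetric] powr_diff powr_powr)
  have "(1 / 2 ^ j) powr \<alpha> * (2 ^ Suc j / l) powr (real n + \<delta>) * (2 * (l / 2 ^ j)) ^ n
      = (2 powr (- (real j * \<alpha>)) * 2 powr ((real j + 1) * (real n + \<delta>)) * 2 powr (real n - real j * real n))
        * (l powr (- (real n + \<delta>)) * l powr real n)"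
    unfolding 1 2 3 by (simp add: mult_ac)
  also have "\<dots> = 2 powr (2 * real n + \<delta> + real j * (\<delta> - \<alpha>)) * l powr (- \<delta>)"
    by (simp add: powr_add[symmetric] algebra_simps)
  finally show ?thesis
    by (simp add: powr_add powr_power mult_ac)
qed

text \<open>The same count at radius 2^(j+1) l without Hoelder gain: -(n+\<delta>) + n = -\<delta>,
  which is the weight in \<open>F_K_tilde\<close>.\<close>

lemma far_scale_identity:
  fixes l :: real
  assumes "0 < l"
  shows "(1 / (2 ^ j * l)) powr (real n + \<delta>) * (2 * (2 * 2 ^ j * l)) ^ n
    = 4 ^ n * l powr (- \<delta>) * 2 powr (- (real j * \<delta>))"
proof -
  have "(1 / (2 ^ j * l)) powr (real n + \<delta>) = (2 ^ j * l) powr (- (real n + \<delta>))"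
    using assms by (subst powr_minus_divide) (simp add: powr_divide)
  also have "\<dots> = 2 powr (- (real j * (real n + \<delta>))) * l powr (- (real n + \<delta>))"
  proof -
    have "(2 ^ j * l) powr e = 2 powr (real j * e) * l powr e" for e
      using assms by (simp add: powr_mult powr_realpow[symmetric] powr_powr)
    then show ?thesis unfolding mult_minus_right[symmetric] .
  qed
  finally have 1: "(1 / (2 ^ j * l)) powr (real n + \<delta>) = 2 powr (- (real j * (real n + \<delta>))) * l powr (- (real n + \<delta>))" .
  have 2: "(2 * (2 * 2 ^ j * l)) ^ n = 4 ^ n * (2 powr (real j * real n) * l powr real n)"
  proof -
    have "(2 * (2 * 2 ^ j * l)) ^ n = (4 * (2 ^ j * l)) ^ n" by simp
    also have "\<dots> = 4 ^ n * ((2 ^ j) ^ n * l ^ n)" by (simp only: power_mult_distrib)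
    also have "(2 ^ j) ^ n = (2::real) powr (real j * real n)"
      by (simp add: powr_realpow powr_powr[symmetric])
    finally show ?thesis using assms by (simp add: powr_realpow)
  qed
  have "(1 / (2 ^ j * l)) powr (real n + \<delta>) * (2 * (2 * 2 ^ j * l)) ^ n
      = 4 ^ n * (2 powr (- (real j * (real n + \<delta>))) * 2 powr (real j * real n))
        * (l powr (- (real n + \<delta>)) * l powr real n)"
    unfolding 1 2 by (simp add: mult_ac)
  also have "\<dots> = 4 ^ n * 2 powr (- (real j * \<delta>)) * l powr (- \<delta>)"
    by (simp add: powr_add[symmetric] algebra_simps)
  finally show ?thesis by (simp add: mult_ac)
qed

lemma dilate_mem_cubes: "I \<in> cubes \<Longrightarrow> 0 < r \<Longrightarrow> dilate r I \<in> cubes"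
  by (simp add: cubes_def dilate_def)

lemma unit_cube_mem_cubes: "unit_cube \<in> cubes"
  by (simp add: cubes_def unit_cube_def)

lemma rdist_unit_cube_nonneg: "I \<in> cubes \<Longrightarrow> 0 \<le> rdist I unit_cube"
  using rdist_ge_1[OF _ unit_cube_mem_cubes, of I] by linarith

text \<open>Monotonicity bounds \<open>D\<close> by D(0), leaving a geometric series of ratio
  2^(-\<delta>). Without convergence the \<open>suminf\<close> in \<open>F_K_tilde\<close> would
  carry no information.\<close>

lemma summable_F_K_tilde:
  assumes adm: "admissible_functions L S D" and "0 < \<delta>" "I \<in> cubes"
  shows "summable (\<lambda>j. 2 powr (- (real j * \<delta>)) * D (1 / 10 * rdist (dilate (2 ^ j) I) unit_cube))"
proof (rule summable_comparison_test)
  have "2 powr (- (real j * \<delta>)) = (2 powr (- \<delta>)) ^ j" for j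
    by (simp add: powr_power mult.commute)
  moreover have "summable (\<lambda>j. (2 powr (- \<delta>)) ^ j * D 0)"
    using \<open>0 < \<delta>\<close> powr_less_mono[of "- \<delta>" 0 "2::real"] by (intro summable_mult2 summable_geometric) auto
  ultimately show "summable (\<lambda>j. 2 powr (- (real j * \<delta>)) * D 0)" by simp
  have "0 \<le> 1 / 10 * rdist (dilate (2 ^ j) I) unit_cube" for j
    using rdist_unit_cube_nonneg[OF dilate_mem_cubes[OF assms(3), of "2 ^ j"]] by simp
  then show "\<exists>N. \<forall>j\<ge>N. norm (2 powr (- (real j * \<delta>)) * D (1 / 10 * rdist (dilate (2 ^ j) I) unit_cube))
      \<le> 2 powr (- (real j * \<delta>)) * D 0"
    using admissible_functionsD[OF adm] by (auto simp: abs_mult)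
qed

subsection \<open>The remainder away from the smaller cube\<close>

text \<open>Diagonal values of the kernel are arbitrary. The prefactor vanishes wherever x = t or c
  = t, so the integrand equals its restriction to the open set where it is continuous.\<close>

lemma borel_measurable_kernel_difference:
  fixes K :: "real^('n::finite) \<Rightarrow> real^'n \<Rightarrow> complex"
  assumes K: "continuous_on {z. fst z \<noteq> snd z} (\<lambda>(x, t). K x t)"
    and "continuous_on UNIV f" "continuous_on UNIV g"
    and zero: "\<And>x t. x = t \<or> c = t \<Longrightarrow> f t * g x = 0"
  shows "(\<lambda>(x, t). f t * g x * (K x t - K c t)) \<in> borel_measurable (lborel \<Otimes>\<^sub>M lborel)"
proof -
  define U where "U = {z. fst z \<noteq> snd z \<and> c \<noteq> snd z}"
  have U: "open U"
    unfolding U_def by (intro open_Collect_conj open_Collect_neq continuous_intros)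
  have "continuous_on U (\<lambda>z. f (snd z))" "continuous_on U (\<lambda>z. g (fst z))"
    using assms(2,3) by (auto intro!: continuous_on_compose2[of UNIV _ _ snd]
        continuous_on_compose2[of UNIV _ _ fst] continuous_intros)
  moreover have "continuous_on U (\<lambda>z. (\<lambda>(x, t). K x t) (c, snd z))"
    by (rule continuous_on_compose2[OF K]) (auto simp: U_def intro!: continuous_intros)
  moreover have "continuous_on U (\<lambda>z. (\<lambda>(x, t). K x t) z)"
    by (rule continuous_on_subset[OF K]) (auto simp: U_def)
  ultimately have "continuous_on U (\<lambda>(x, t). f t * g x * (K x t - K c t))"
    by (auto simp: case_prod_beta intro!: continuous_intros)
  then have "(\<lambda>z. indicator U z *\<^sub>R (\<lambda>(x, t). f t * g x * (K x t - K c t)) z) \<in> borel_measurable borel"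
    using U by (intro borel_measurable_continuous_on_indicator) auto
  also have "(\<lambda>z. indicator U z *\<^sub>R (\<lambda>(x, t). f t * g x * (K x t - K c t)) z)
      = (\<lambda>(x, t). f t * g x * (K x t - K c t))"
    using zero by (auto simp: indicator_def U_def)
  finally show ?thesis by (simp add: lborel_prod)
qed

text \<open>The first constant is the sum of the geometric series over the inner balls. In the
  second, 4^n is ball volume against inner radius, and 2 comes from bounding
  \<open>\<psi>\<^sub>I t - \<psi>\<^sub>I c\<close> by twice the supremum.\<close>

lemma remainder_estimate:
  fixes K :: "real^('n::{finite,linorder}) \<Rightarrow> real^('n::{finite,linorder}) \<Rightarrow> complex"
    and I J :: "('n::{finite,linorder}) cube" and \<psi>\<^sub>I \<psi>\<^sub>J :: "real^('n::{finite,linorder}) \<Rightarrow> complex" and \<Phi> :: "real^('n::{finite,linorder}) \<Rightarrow> real"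
  defines "c \<equiv> center J" and "n \<equiv> CARD('n)"
  defines "E \<equiv> (\<lambda>(x, t). complex_of_real (1 - \<Phi> t) * (\<psi>\<^sub>I t - \<psi>\<^sub>I c) * \<psi>\<^sub>J x * (K x t - K c t))"
  assumes reg: "kernel_regularity K \<delta> L S D B" and "0 < \<delta>" "\<delta> < \<alpha>"
    and I: "I \<in> cubes" and J: "J \<in> cubes" and le: "side J \<le> side I" and near: "rdist I J \<le> 3"
    and "0 < C" and bI: "bump_order1 I C N \<alpha> \<psi>\<^sub>I" and bJ: "bump_order1 J C N \<alpha> \<psi>\<^sub>J"
    and supp: "supp \<psi>\<^sub>J \<subseteq> cube_set J"
    and \<Phi>: "continuous_on UNIV \<Phi>" "\<And>t. 0 \<le> \<Phi> t \<and> \<Phi> t \<le> 1"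
      "\<And>t. infnorm (t - c) \<le> side J \<Longrightarrow> \<Phi> t = 1"
  shows "integrable (lborel \<Otimes>\<^sub>M lborel) E"
    "cmod (integral\<^sup>L (lborel \<Otimes>\<^sub>M lborel) E)
      \<le> B * C\<^sup>2 * (side J / side I) powr (real n / 2 + \<delta>) * S (side J)
        * (2 powr (2 * real n + \<delta>) / (1 - 2 powr (\<delta> - \<alpha>)) * (L (side J) * D (1 / 10 * rdist I unit_cube))
           + 2 * 4 ^ n * (L (side I)
               * (\<Sum>j. 2 powr (- (real j * \<delta>)) * D (1 / 10 * rdist (dilate (2 ^ j) I) unit_cube))))"
proof -
  note adm = kernel_regularityD(1)[OF reg]
  have B: "0 < B" by (rule kernel_regularityD(2)[OF reg])
  have s: "0 < side I" "0 < side J" using I J by (auto simp: cubes_def)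
  define vI where "vI = cube_vol I powr (-1/2)"
  define vJ where "vJ = cube_vol J powr (-1/2)"
  define DI where "DI = D (1 / 10 * rdist I unit_cube)"
  define Dj where "Dj j = D (1 / 10 * rdist (dilate (2 ^ j) I) unit_cube)" for j :: nat
  define P where "P = C * vI * (C * vJ) * (B * side J powr \<delta> * S (side J))"
  \<comment> \<open>Up to the common amplitude \<open>P\<close>, \<open>a j\<close> bounds the
    integrand for |t-c| between l(I)/2^(j+1) and l(I)/2^j, and \<open>b j\<close> bounds it between
    2^j l(I) and 2^(j+1) l(I).\<close>
  define a where "a j = (1 / 2 ^ j) powr \<alpha> * (2 ^ Suc j / side I) powr (real n + \<delta>) * (L (side J) * DI)" for j :: nat
  define b where "b j = 2 * (1 / (2 ^ j * side I)) powr (real n + \<delta>) * (L (side I) * Dj j)" for j :: nat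
  define G1 where "G1 t = (\<Sum>j. ennreal (a j) * indicator {t. infnorm (t - c) \<le> side I / 2 ^ j} t)" for t
  define G2 where "G2 t = (\<Sum>j. ennreal (b j) * indicator {t. infnorm (t - c) \<le> 2 * 2 ^ j * side I} t)" for t
  have DI: "0 \<le> DI" and Dj: "0 \<le> Dj j" for j
    unfolding DI_def Dj_def
    using rdist_unit_cube_nonneg[OF I] rdist_unit_cube_nonneg[OF dilate_mem_cubes[OF I, of "2 ^ j"]]
    by (auto intro!: admissible_functionsD[OF adm])
  have LS: "0 \<le> L (side I)" "0 \<le> L (side J)" "0 \<le> S (side J)"
    using s by (auto intro!: admissible_functionsD[OF adm])
  have P: "0 \<le> P"
    unfolding P_def vI_def vJ_def using LS B \<open>0 < C\<close> by (intro mult_nonneg_nonneg) auto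
  have a: "0 \<le> a j" and b: "0 \<le> b j" for j
    unfolding a_def b_def using LS DI Dj by auto
  have sym: "infnorm (c - t) = infnorm (t - c)" for t by (rule infnorm_sub)
  \<comment> \<open>The four free bounds (oscillation, kernel size, \<open>L\<close>,
    \<open>D\<close>) are all that differs between inner and outer annuli.\<close>
  have pointwise: "norm (E (x, t)) \<le> P * (m * w * (l * d))"
    if x: "x \<in> cube_set J" and t: "side J < infnorm (c - t)"
      and m: "cmod (\<psi>\<^sub>I t - \<psi>\<^sub>I c) \<le> C * vI * m" and w: "1 / infnorm (c - t) powr (real n + \<delta>) \<le> w"
      and l: "L (infnorm (c - t)) \<le> l"
      and d: "D (1 + infnorm (c + t) / (1 + infnorm (c - t))) \<le> d" for x t m w l d
  proof -
    have arg: "0 \<le> 1 + infnorm (c + t) / (1 + infnorm (c - t))" by (simp add: infnorm_pos_le)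
    have nn: "0 \<le> L (infnorm (c - t))" "0 \<le> D (1 + infnorm (c + t) / (1 + infnorm (c - t)))"
      using admissible_functionsD(1)[OF adm infnorm_pos_le] admissible_functionsD(3)[OF adm arg] by auto
    have "norm (E (x, t)) = \<bar>1 - \<Phi> t\<bar> * cmod (\<psi>\<^sub>I t - \<psi>\<^sub>I c) * cmod (\<psi>\<^sub>J x) * cmod (K x t - K c t)"
      unfolding E_def by (simp only: prod.case norm_mult norm_of_real)
    also have "\<dots> \<le> 1 * (C * vI * m) * (C * vJ)
        * (B * side J powr \<delta> * S (side J) * w * l * d)"
    proof (intro mult_mono)
      show "\<bar>1 - \<Phi> t\<bar> \<le> 1" using \<Phi>(2)[of t] by (simp add: abs_le_iff)
      show "cmod (\<psi>\<^sub>J x) \<le> C * vJ"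
        using bump_order0_le[of J C N \<psi>\<^sub>J x] bJ J \<open>0 < C\<close> by (simp add: bump_order1_def vJ_def)
      have "cmod (K x t - K c t) \<le> B * side J powr \<delta> * S (side J) * (1 / infnorm (c - t) powr (real n + \<delta>))
          * L (infnorm (c - t)) * D (1 + infnorm (c + t) / (1 + infnorm (c - t)))"
        using kernel_difference_bound[OF reg \<open>0 < \<delta>\<close> J x, of t] t by (simp add: c_def n_def)
      also have "\<dots> \<le> B * side J powr \<delta> * S (side J) * w * l * d"
        using w l d nn LS B
        by (intro mult_mono mult_nonneg_nonneg) (auto intro: order_trans[OF _ w] order_trans[OF _ l])
      finally show "cmod (K x t - K c t) \<le> B * side J powr \<delta> * S (side J) * w * l * d" .
      show "0 \<le> 1 * (C * vI * m) * (C * vJ)" "0 \<le> 1 * (C * vI * m)"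
        using order_trans[OF norm_ge_zero m] \<open>0 < C\<close> by (auto simp: vJ_def)
    qed (use m in auto)
    also have "\<dots> = P * (m * w * (l * d))" by (simp add: P_def mult_ac)
    finally show ?thesis .
  qed
  have cI: "infnorm (c - center I) \<le> 3 * side I"
    unfolding c_def by (rule infnorm_centers_le[OF I J le near])
  have bound: "ennreal (norm (E (x, t))) \<le> indicator (cube_set J) x * (ennreal P * (G1 t + G2 t))" for x t
  proof -
    consider "x \<notin> cube_set J" | "infnorm (c - t) \<le> side J"
      | "x \<in> cube_set J" "side J < infnorm (c - t)" "infnorm (c - t) \<le> side I"
      | "x \<in> cube_set J" "side J < infnorm (c - t)" "side I < infnorm (c - t)" by linarith
    then show ?thesis
    proof cases
      case 1
      then have "\<psi>\<^sub>J x = 0" using supp in_supp[of \<psi>\<^sub>J x] by auto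
      then show ?thesis by (simp add: E_def)
    next
      case 2
      then have "\<Phi> t = 1" using \<Phi>(3)[of t] by (simp add: sym)
      then show ?thesis by (simp add: E_def)
    next
      case 3
      let ?d = "infnorm (c - t)"
      have d: "0 < ?d" using 3 s by linarith
      then have "1 \<le> side I / ?d" using 3 by simp
      then obtain j where j: "2 ^ j \<le> side I / ?d" "side I / ?d < 2 ^ Suc j"
        by (rule dyadic_scale)
      have d1: "?d \<le> side I / 2 ^ j" using j(1) d by (simp add: field_simps)
      have d2: "side I / 2 ^ Suc j < ?d" using j(2) d by (simp add: field_simps)
      have "norm (E (x, t)) \<le> P * ((1 / 2 ^ j) powr \<alpha> * (2 ^ Suc j / side I) powr (real n + \<delta>)
          * (L (side J) * DI))"
      proof (rule pointwise[OF 3(1,2)])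
        have "cmod (\<psi>\<^sub>I t - \<psi>\<^sub>I c) \<le> C * vI * (?d / side I) powr \<alpha>"
          using bump_order1_diff_le[OF bI I \<open>0 < C\<close>, of t c] by (simp add: vI_def sym)
        also have "\<dots> \<le> C * vI * (1 / 2 ^ j) powr \<alpha>"
          using d1 d s \<open>0 < C\<close> \<open>0 < \<delta>\<close> \<open>\<delta> < \<alpha>\<close>
          by (intro mult_left_mono powr_mono2) (auto simp: vI_def field_simps)
        finally show "cmod (\<psi>\<^sub>I t - \<psi>\<^sub>I c) \<le> C * vI * (1 / 2 ^ j) powr \<alpha>" .
        have "1 / ?d powr (real n + \<delta>) = (1 / ?d) powr (real n + \<delta>)"
          using d by (simp add: powr_divide)
        also have "\<dots> \<le> (2 ^ Suc j / side I) powr (real n + \<delta>)"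
          using d2 d s \<open>0 < \<delta>\<close> by (intro powr_mono2) (auto simp: field_simps)
        finally show "1 / ?d powr (real n + \<delta>) \<le> (2 ^ Suc j / side I) powr (real n + \<delta>)" .
        show "L ?d \<le> L (side J)" using 3 s by (intro admissible_functionsD[OF adm]) auto
        show "D (1 + infnorm (c + t) / (1 + ?d)) \<le> DI"
          unfolding DI_def
          using rdist_unit_cube_le_kernel_argument[OF I, of c t] 3 s cI rdist_unit_cube_nonneg[OF I]
          by (intro admissible_functionsD[OF adm]) auto
      qed
      then have "ennreal (norm (E (x, t))) \<le> ennreal P * ennreal (a j)"
        using P a by (simp add: a_def ennreal_mult[symmetric])
      also have "ennreal (a j) \<le> G1 t"
        unfolding G1_def using d1 sum_le_suminf[of "\<lambda>j. ennreal (a j) * indicator {t. infnorm (t - c) \<le> side I / 2 ^ j} t" "{j}"]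
        by (simp add: summableI sym)
      also have "\<dots> \<le> G1 t + G2 t" by simp
      finally show ?thesis using 3 by (simp add: mult_left_mono)
    next
      case 4
      let ?d = "infnorm (c - t)"
      have d: "0 < ?d" using 4 s by linarith
      then have "1 < ?d / side I" using 4 s by simp
      then obtain j where j: "2 ^ j < ?d / side I" "?d / side I \<le> 2 ^ Suc j"
        by (rule dyadic_scale')
      have d1: "?d \<le> 2 * 2 ^ j * side I" using j(2) s by (simp add: field_simps)
      have d2: "2 ^ j * side I < ?d" using j(1) s by (simp add: field_simps)
      have "norm (E (x, t)) \<le> P * (2 * (1 / (2 ^ j * side I)) powr (real n + \<delta>)
          * (L (side I) * Dj j))"
      proof (rule pointwise[OF 4(1,2)])
        have "cmod (\<psi>\<^sub>I t - \<psi>\<^sub>I c) \<le> cmod (\<psi>\<^sub>I t) + cmod (\<psi>\<^sub>I c)" by (rule norm_triangle_ineq4)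
        also have "\<dots> \<le> C * vI + C * vI"
          using bump_order0_le[of I C N \<psi>\<^sub>I] bI I \<open>0 < C\<close>
          by (intro add_mono) (simp_all add: bump_order1_def vI_def)
        finally show "cmod (\<psi>\<^sub>I t - \<psi>\<^sub>I c) \<le> C * vI * 2" by simp
        have "1 / ?d powr (real n + \<delta>) = (1 / ?d) powr (real n + \<delta>)"
          using d by (simp add: powr_divide)
        also have "\<dots> \<le> (1 / (2 ^ j * side I)) powr (real n + \<delta>)"
          using d2 d s \<open>0 < \<delta>\<close> by (intro powr_mono2) (auto simp: field_simps)
        finally show "1 / ?d powr (real n + \<delta>) \<le> (1 / (2 ^ j * side I)) powr (real n + \<delta>)" .
        show "L ?d \<le> L (side I)" using 4 s by (intro admissible_functionsD[OF adm]) auto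
        \<comment> \<open>On this annulus |c-t| is at most twice the side of 2^j I, so the
          comparison lemma applies to that dilate; this is how the dilates in
          \<open>F_K_tilde\<close> arise.\<close>
        have "3 * side I \<le> 3 * (2 ^ j * side I)" using s by simp
        then have "infnorm (c - center I) \<le> 3 * (2 ^ j * side I)" using cI by linarith
        then show "D (1 + infnorm (c + t) / (1 + ?d)) \<le> Dj j"
          unfolding Dj_def
          using rdist_unit_cube_le_kernel_argument[OF dilate_mem_cubes[OF I, of "2 ^ j"], of c t]
            rdist_unit_cube_nonneg[OF dilate_mem_cubes[OF I, of "2 ^ j"]] d1 s
          by (intro admissible_functionsD[OF adm]) (auto simp: dilate_def)
      qed
      then have "ennreal (norm (E (x, t))) \<le> ennreal P * ennreal (b j)"
        using P b by (simp add: b_def ennreal_mult[symmetric])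
      also have "ennreal (b j) \<le> G2 t"
        unfolding G2_def using d1 sum_le_suminf[of "\<lambda>j. ennreal (b j) * indicator {t. infnorm (t - c) \<le> 2 * 2 ^ j * side I} t" "{j}"]
        by (simp add: summableI sym)
      also have "\<dots> \<le> G1 t + G2 t" by simp
      finally show ?thesis using 4 by (simp add: mult_left_mono)
    qed
  qed
  \<comment> \<open>\<open>X\<close> and \<open>Y\<close> are the two series without their common
    factor l(I)^(-\<delta>), which turns l(J)^\<delta> from the regularity bound into
    (l(J)/l(I))^\<delta>.\<close>
  define X where "X = 2 powr (2 * real n + \<delta>) / (1 - 2 powr (\<delta> - \<alpha>)) * (L (side J) * DI)"
  define Y where "Y = 2 * 4 ^ n * (L (side I) * (\<Sum>j. 2 powr (- (real j * \<delta>)) * Dj j))"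
  have geo: "2 powr (\<delta> - \<alpha>) < (1::real)"
    using \<open>\<delta> < \<alpha>\<close> powr_less_mono[of "\<delta> - \<alpha>" 0 "2::real"] by simp
  have suma: "(\<lambda>j. a j * (2 * (side I / 2 ^ j)) ^ n) sums (side I powr (- \<delta>) * X)"
  proof -
    have "a j * (2 * (side I / 2 ^ j)) ^ n
        = 2 powr (2 * real n + \<delta>) * side I powr (- \<delta>) * (L (side J) * DI) * (2 powr (\<delta> - \<alpha>)) ^ j" for j
      using near_scale_identity[OF s(1), of j \<alpha> n \<delta>] unfolding a_def by (simp add: mult_ac)
    moreover have "(\<lambda>j. 2 powr (2 * real n + \<delta>) * side I powr (- \<delta>) * (L (side J) * DI) * (2 powr (\<delta> - \<alpha>)) ^ j)
        sums (2 powr (2 * real n + \<delta>) * side I powr (- \<delta>) * (L (side J) * DI) * (1 / (1 - 2 powr (\<delta> - \<alpha>))))"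
      using geo by (intro sums_mult geometric_sums) simp
    ultimately show ?thesis by (simp add: X_def mult_ac)
  qed
  have sumb: "(\<lambda>j. b j * (2 * (2 * 2 ^ j * side I)) ^ n) sums (side I powr (- \<delta>) * Y)"
  proof -
    have "b j * (2 * (2 * 2 ^ j * side I)) ^ n
        = 2 * 4 ^ n * side I powr (- \<delta>) * L (side I) * (2 powr (- (real j * \<delta>)) * Dj j)" for j
      using far_scale_identity[OF s(1), of j n \<delta>] unfolding b_def by (simp add: mult_ac)
    moreover have "(\<lambda>j. 2 * 4 ^ n * side I powr (- \<delta>) * L (side I) * (2 powr (- (real j * \<delta>)) * Dj j))
        sums (2 * 4 ^ n * side I powr (- \<delta>) * L (side I) * (\<Sum>j. 2 powr (- (real j * \<delta>)) * Dj j))"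
      using summable_F_K_tilde[OF adm \<open>0 < \<delta>\<close> I] unfolding Dj_def
      by (intro sums_mult summable_sums)
    ultimately show ?thesis by (simp add: Y_def mult_ac)
  qed
  have XY: "0 \<le> X" "0 \<le> Y"
    unfolding X_def Y_def using geo LS DI Dj summable_F_K_tilde[OF adm \<open>0 < \<delta>\<close> I]
    by (auto intro!: mult_nonneg_nonneg divide_nonneg_nonneg suminf_nonneg simp: Dj_def)
  have G_meas[measurable]: "G1 \<in> borel_measurable borel" "G2 \<in> borel_measurable borel"
    unfolding G1_def G2_def using infnorm_cball_borel by measurable
  have "(\<integral>\<^sup>+t. ennreal P * (G1 t + G2 t) \<partial>lborel) = ennreal P * ((\<integral>\<^sup>+t. G1 t \<partial>lborel) + (\<integral>\<^sup>+t. G2 t \<partial>lborel))"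
    by (simp add: nn_integral_cmult nn_integral_add)
  also have "\<dots> = ennreal P * (ennreal (side I powr (- \<delta>) * X) + ennreal (side I powr (- \<delta>) * Y))"
    unfolding G1_def G2_def using suma sumb a b s
    by (subst (1 2) nn_integral_infnorm_cballs) (auto simp: n_def)
  also have "\<dots> = ennreal (P * (side I powr (- \<delta>) * (X + Y)))"
    using P XY by (simp add: ennreal_plus[symmetric] ennreal_mult[symmetric] distrib_left[symmetric])
  finally have int: "(\<integral>\<^sup>+t. ennreal P * (G1 t + G2 t) \<partial>lborel) \<le> ennreal (P * (side I powr (- \<delta>) * (X + Y)))"
    by simp
  have meas: "E \<in> borel_measurable (lborel \<Otimes>\<^sub>M lborel)"
    unfolding E_def
  proof (rule borel_measurable_kernel_difference[OF continuous_on_kernel[OF reg \<open>0 < \<delta>\<close>]])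
    show "continuous_on UNIV (\<lambda>t. complex_of_real (1 - \<Phi> t) * (\<psi>\<^sub>I t - \<psi>\<^sub>I c))" "continuous_on UNIV \<psi>\<^sub>J"
      using \<Phi>(1) bI bJ unfolding bump_order1_def by (auto intro!: continuous_intros)
    fix x t assume "x = t \<or> c = t"
    \<comment> \<open>On the diagonal either x lies outside \<open>J\<close>, or t = x lies in
      \<open>J\<close>, where |t-c| \<le> l(J)/2 and the cutoff equals 1.\<close>
    moreover have "\<Phi> t = 1 \<or> \<psi>\<^sub>J x = 0" if "x = t"
      using \<Phi>(3)[of t] supp in_supp[of \<psi>\<^sub>J x] that s by (force simp: mem_cube_set c_def)
    moreover have "\<Phi> t = 1" if "c = t" using \<Phi>(3)[of t] that s by (simp add: infnorm_0)
    ultimately show "complex_of_real (1 - \<Phi> t) * (\<psi>\<^sub>I t - \<psi>\<^sub>I c) * \<psi>\<^sub>J x = 0" by auto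
  qed
  have Qset: "cube_set J \<in> sets borel" by (simp add: cube_set_def)
  have G: "(\<lambda>t. ennreal P * (G1 t + G2 t)) \<in> borel_measurable borel" by measurable
  have nn: "0 \<le> cube_vol J" "0 \<le> P * (side I powr (- \<delta>) * (X + Y))"
    using cube_vol_pos[OF J] P XY by auto
  have eJ: "emeasure lborel (cube_set J) = ennreal (cube_vol J)"
    using s by (intro emeasure_cube_set) simp
  note res = product_integral_bound[OF meas Qset G bound eJ nn(1) int nn(2)]
  show "integrable (lborel \<Otimes>\<^sub>M lborel) E" by (rule res(1))
  have "cube_vol J * (vI * vJ * side J powr \<delta> * side I powr (- \<delta>)) = (side J / side I) powr (real n / 2 + \<delta>)"
  proof -
    have "cube_vol J = side J powr real n"
      using s by (simp add: cube_vol_def powr_realpow n_def)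
    then have "cube_vol J * (vI * vJ * side J powr \<delta> * side I powr (- \<delta>))
        = (side J powr real n * side J powr (real n * (-1/2)) * side J powr \<delta>)
          * (side I powr (real n * (-1/2)) * side I powr (- \<delta>))"
      unfolding vI_def vJ_def cube_vol_powr[OF I] cube_vol_powr[OF J] n_def by (simp add: mult_ac)
    also have "\<dots> = side J powr (real n / 2 + \<delta>) * side I powr (- (real n / 2 + \<delta>))"
      by (simp add: powr_add[symmetric])
    also have "\<dots> = (side J / side I) powr (real n / 2 + \<delta>)"
      using s by (subst powr_divide) (simp_all only: powr_minus divide_inverse)
    finally show ?thesis .
  qed
  then have "cube_vol J * (P * (side I powr (- \<delta>) * (X + Y)))
      = B * C\<^sup>2 * (side J / side I) powr (real n / 2 + \<delta>) * S (side J) * (X + Y)"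
    unfolding P_def by (simp add: power2_eq_square mult_ac)
  with res(2) show "cmod (integral\<^sup>L (lborel \<Otimes>\<^sub>M lborel) E)
      \<le> B * C\<^sup>2 * (side J / side I) powr (real n / 2 + \<delta>) * S (side J)
        * (2 powr (2 * real n + \<delta>) / (1 - 2 powr (\<delta> - \<alpha>)) * (L (side J) * D (1 / 10 * rdist I unit_cube))
           + 2 * 4 ^ n * (L (side I)
               * (\<Sum>j. 2 powr (- (real j * \<delta>)) * D (1 / 10 * rdist (dilate (2 ^ j) I) unit_cube))))"
    by (simp only: X_def Y_def DI_def Dj_def)
qed

subsection \<open>Separated cubes\<close>

text \<open>On I x J the distance |c-t| is at least a third of the side of the hull
  \<open>H\<close>, so the integrand has a uniform bound \<open>M\<close>; the third gives the
  factor 3^(n+\<delta>). Integration leaves (|I||J|)^(1/2) l(J)^\<delta> / l(H)^(n+\<delta>), and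
  l(H) = rdist(I,J) l(I) turns this into the claimed quotient.\<close>

lemma far_estimate:
  fixes K :: "real^('n::{finite,linorder}) \<Rightarrow> real^('n::{finite,linorder}) \<Rightarrow> complex"
    and I J :: "('n::{finite,linorder}) cube"
  assumes reg: "kernel_regularity K \<delta> L S D B" and "0 < \<delta>" and "associated_with T K"
    and I: "I \<in> cubes" and J: "J \<in> cubes" and le: "side J \<le> side I" and far: "3 < rdist I J"
    and "0 < C" and bI: "bump_order1 I C N \<alpha> \<psi>\<^sub>I" and bJ: "bump_order1 J C N \<alpha> \<psi>\<^sub>J"
    and sI: "supp \<psi>\<^sub>I \<subseteq> cube_set I" and sJ: "supp \<psi>\<^sub>J \<subseteq> cube_set J"
    and zero: "integral\<^sup>L lborel \<psi>\<^sub>J = 0"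
  defines "n \<equiv> CARD('n)" and "H \<equiv> cube_hull I J"
  shows "cmod (T \<psi>\<^sub>I \<psi>\<^sub>J) \<le> 3 powr (real n + \<delta>) * B * C\<^sup>2
      * ((side J / side I) powr (real n / 2 + \<delta>) / rdist I J powr (real n + \<delta>))
      * (L (1 / 10 * side H) * S (side J) * D (1 / 10 * rdist H unit_cube))"
proof -
  note adm = kernel_regularityD(1)[OF reg]
  have B: "0 < B" by (rule kernel_regularityD(2)[OF reg])
  have s: "0 < side I" "0 < side J" using I J by (auto simp: cubes_def)
  define c where "c = center J"
  define vI where "vI = cube_vol I powr (-1/2)"
  define vJ where "vJ = cube_vol J powr (-1/2)"
  have c: "c \<in> cube_set J" unfolding c_def using s by (intro center_mem_cube_set) simp
  note sep = far_cubes_separated[OF I J le far, folded H_def]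
  have disj: "cube_set I \<inter> cube_set J = {}"
    using sep(2) s by (force simp: infnorm_0)
  have H: "H \<in> cubes" and IH: "side I \<le> side H"
    unfolding H_def using max_side_le_hull[OF I J] s by (auto simp: cubes_def)
  have sH: "0 < side H" using H by (simp add: cubes_def)
  have C0: "\<psi>\<^sub>I \<in> C0" "\<psi>\<^sub>J \<in> C0"
    using bI bJ sI sJ by (auto intro!: C0_of_compact compact_cube_set simp: bump_order1_def)
  define E where "E = (\<lambda>(x, t). \<psi>\<^sub>I t * \<psi>\<^sub>J x * (K x t - K c t))"
  have dsupp: "supp \<psi>\<^sub>I \<inter> supp \<psi>\<^sub>J = {}" "c \<notin> supp \<psi>\<^sub>I"
    using disj sI sJ c by auto
  note pairing = pairing_kernel_difference[OF \<open>associated_with T K\<close>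
      continuous_on_kernel[OF reg \<open>0 < \<delta>\<close>] C0 dsupp zero, folded E_def]
  define W where "W = L (1 / 10 * side H) * D (1 / 10 * rdist H unit_cube)"
  define M where "M = C * vI * (C * vJ)
      * (B * side J powr \<delta> * S (side J) * (3 powr (real n + \<delta>) / side H powr (real n + \<delta>)) * W)"
  have rH: "0 \<le> 1 / 10 * rdist H unit_cube" using rdist_unit_cube_nonneg[OF H] by simp
  have LS: "0 \<le> L (1 / 10 * side H)" "0 \<le> S (side J)" "0 \<le> D (1 / 10 * rdist H unit_cube)"
    using s sH rH by (auto intro!: admissible_functionsD[OF adm])
  have M: "0 \<le> M"
    unfolding M_def W_def vI_def vJ_def using LS B \<open>0 < C\<close>
    by (intro mult_nonneg_nonneg divide_nonneg_nonneg) auto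
  have pointwise: "norm (E (x, t)) \<le> M" if x: "x \<in> cube_set J" and t: "t \<in> cube_set I" for x t
  proof -
    let ?d = "infnorm (c - t)"
    have d: "side H / 3 \<le> ?d" "side I < ?d" by (rule sep[OF t c])+
    have in_H: "c \<in> cube_set H" "t \<in> cube_set H"
      using cube_subset_hull[OF I J] c t by (auto simp: H_def)
    have d': "?d \<le> 2 * side H" "infnorm (c - center H) \<le> 3 * side H"
      using infnorm_diff_le_of_mem_cube[OF in_H] in_H(1) sH by (auto simp: mem_cube_set)
    have arg: "0 \<le> 1 + infnorm (c + t) / (1 + ?d)" by (simp add: infnorm_pos_le)
    have "cmod (K x t - K c t)
        \<le> B * side J powr \<delta> * S (side J) / ?d powr (real n + \<delta>) * L ?d * D (1 + infnorm (c + t) / (1 + ?d))"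
      using kernel_difference_bound[OF reg \<open>0 < \<delta>\<close> J x, of t] d le by (simp add: c_def n_def)
    also have "\<dots> = B * side J powr \<delta> * S (side J) * (1 / ?d powr (real n + \<delta>)) * (L ?d * D (1 + infnorm (c + t) / (1 + ?d)))"
      by simp
    also have "\<dots> \<le> B * side J powr \<delta> * S (side J) * (3 powr (real n + \<delta>) / side H powr (real n + \<delta>)) * W"
    proof (intro mult_mono mult_left_mono)
      have "1 / ?d powr (real n + \<delta>) = (1 / ?d) powr (real n + \<delta>)"
        using d s by (simp add: powr_divide)
      also have "\<dots> \<le> (3 / side H) powr (real n + \<delta>)"
        using d s sH \<open>0 < \<delta>\<close> by (intro powr_mono2) (auto simp: field_simps)
      also have "\<dots> = 3 powr (real n + \<delta>) / side H powr (real n + \<delta>)"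
        using sH by (simp add: powr_divide)
      finally show "1 / ?d powr (real n + \<delta>) \<le> 3 powr (real n + \<delta>) / side H powr (real n + \<delta>)" .
      show "L ?d * D (1 + infnorm (c + t) / (1 + ?d)) \<le> W"
        unfolding W_def
      proof (rule mult_mono)
        \<comment> \<open>The separation would allow 1/3; 1/10 is weaker and shared with
          \<open>D\<close>.\<close>
        show "L ?d \<le> L (1 / 10 * side H)" using d sH by (intro admissible_functionsD[OF adm]) auto
        show "D (1 + infnorm (c + t) / (1 + ?d)) \<le> D (1 / 10 * rdist H unit_cube)"
          using rdist_unit_cube_le_kernel_argument[OF H d'] rH by (intro admissible_functionsD[OF adm]) auto
      qed (use LS admissible_functionsD(3)[OF adm arg] in auto)
      show "0 \<le> L ?d * D (1 + infnorm (c + t) / (1 + ?d))"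
        using admissible_functionsD(3)[OF adm arg] admissible_functionsD(1)[OF adm infnorm_pos_le]
        by (intro mult_nonneg_nonneg)
    qed (use LS B in auto)
    finally have K: "cmod (K x t - K c t)
        \<le> B * side J powr \<delta> * S (side J) * (3 powr (real n + \<delta>) / side H powr (real n + \<delta>)) * W" .
    have "norm (E (x, t)) = cmod (\<psi>\<^sub>I t) * cmod (\<psi>\<^sub>J x) * cmod (K x t - K c t)"
      by (simp add: E_def norm_mult)
    also have "\<dots> \<le> M"
      unfolding M_def using K bI bJ I J \<open>0 < C\<close> bump_order0_le[of I C N \<psi>\<^sub>I t] bump_order0_le[of J C N \<psi>\<^sub>J x]
      by (intro mult_mono mult_nonneg_nonneg) (auto simp: bump_order1_def vI_def vJ_def)
    finally show ?thesis .
  qed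
  have bound: "ennreal (norm (E (x, t))) \<le> indicator (cube_set J) x * (ennreal M * indicator (cube_set I) t)" for x t
  proof (cases "x \<in> cube_set J \<and> t \<in> cube_set I")
    case True
    then show ?thesis using pointwise by (simp add: ennreal_leI)
  next
    case False
    then have "\<psi>\<^sub>I t = 0 \<or> \<psi>\<^sub>J x = 0" using sI sJ in_supp[of \<psi>\<^sub>I t] in_supp[of \<psi>\<^sub>J x] by auto
    then show ?thesis by (auto simp: E_def)
  qed
  have sets: "cube_set I \<in> sets borel" "cube_set J \<in> sets borel" by (simp_all add: cube_set_def)
  have "(\<integral>\<^sup>+t. ennreal M * indicator (cube_set I) t \<partial>lborel) = ennreal (M * cube_vol I)"
    using sets s M cube_vol_pos[OF I]
    by (simp add: nn_integral_cmult_indicator emeasure_cube_set ennreal_mult)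
  then have int: "(\<integral>\<^sup>+t. ennreal M * indicator (cube_set I) t \<partial>lborel) \<le> ennreal (M * cube_vol I)" by simp
  have "cmod (integral\<^sup>L (lborel \<Otimes>\<^sub>M lborel) E) \<le> cube_vol J * (M * cube_vol I)"
    using M s cube_vol_pos[OF I] cube_vol_pos[OF J] sets
    by (intro product_integral_bound(2)[OF borel_measurable_integrable[OF pairing(1)] sets(2) _ bound _ _ int]
        emeasure_cube_set) auto
  then have *: "cmod (T \<psi>\<^sub>I \<psi>\<^sub>J) \<le> cube_vol J * (M * cube_vol I)" using pairing(2) by simp
  have r: "rdist I J = side H / side I" using le by (simp add: rdist_def H_def max_def)
  have vol: "cube_vol Q * cube_vol Q powr (-1/2) = side Q powr (real n / 2)" if "Q \<in> cubes" for Q :: "'n cube"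
  proof -
    have "cube_vol Q * cube_vol Q powr (-1/2) = cube_vol Q powr 1 * cube_vol Q powr (-1/2)"
      using cube_vol_pos[OF that] by simp
    also have "\<dots> = side Q powr (real n * 1) * side Q powr (real n * (-1/2))"
      by (simp only: cube_vol_powr[OF that] n_def)
    also have "\<dots> = side Q powr (real n / 2)"
      by (simp add: powr_add[symmetric])
    finally show ?thesis .
  qed
  have scale: "side J powr (real n / 2) * side I powr (real n / 2) * side J powr \<delta> / side H powr (real n + \<delta>)
      = (side J / side I) powr (real n / 2 + \<delta>) / rdist I J powr (real n + \<delta>)"
  proof -
    have 1: "side I powr (real n + \<delta>) / side I powr (real n / 2 + \<delta>) = side I powr (real n / 2)"
      by (simp add: powr_diff[symmetric])
    have "(side J / side I) powr (real n / 2 + \<delta>) / rdist I J powr (real n + \<delta>)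
        = side J powr (real n / 2 + \<delta>) * (side I powr (real n + \<delta>) / side I powr (real n / 2 + \<delta>))
          / side H powr (real n + \<delta>)"
      unfolding r using s sH by (simp add: powr_divide)
    then show ?thesis unfolding 1 by (simp add: powr_add)
  qed
  have "cube_vol J * (M * cube_vol I) = 3 powr (real n + \<delta>) * B * C\<^sup>2
      * ((cube_vol J * vJ) * (cube_vol I * vI) * side J powr \<delta> / side H powr (real n + \<delta>))
      * (L (1 / 10 * side H) * S (side J) * D (1 / 10 * rdist H unit_cube))"
    unfolding M_def W_def by (simp add: power2_eq_square mult_ac)
  then show ?thesis
    using * unfolding vI_def vJ_def vol[OF I] vol[OF J] scale by simp
qed

subsection \<open>Neighbouring cubes\<close>

lemma C0_add: "f \<in> C0 \<Longrightarrow> g \<in> C0 \<Longrightarrow> (\<lambda>x. f x + g x) \<in> C0"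
  by (rule C0_of_compact[of _ "supp f \<union> supp g"])
    (auto simp: C0_def supp_def intro!: continuous_intros closure_mono simp flip: closure_Un)

lemma C0_mult_left:
  fixes f :: "real^'n \<Rightarrow> complex"
  assumes "f \<in> C0" "continuous_on UNIV h"
  shows "(\<lambda>x. h x * f x) \<in> C0"
  using assms
  by (intro C0_of_compact[of _ "supp f"]) (auto simp: C0_def supp_def intro!: continuous_intros closure_mono)

lemma operator_linear:
  assumes "continuous_linear_operator T" "g \<in> C0"
  shows "f \<in> C0 \<Longrightarrow> f' \<in> C0 \<Longrightarrow> T (\<lambda>x. f x + f' x) g = T f g + T f' g"
    "f \<in> C0 \<Longrightarrow> T (\<lambda>x. k * f x) g = k * T f g"
  using assms unfolding continuous_linear_operator_def C0_dual_def by auto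

lemma near_estimate:
  fixes K :: "real^('n::{finite,linorder}) \<Rightarrow> real^('n::{finite,linorder}) \<Rightarrow> complex"
    and I J :: "('n::{finite,linorder}) cube" and F\<^sub>W :: real
  assumes reg: "kernel_regularity K \<delta> L S D B" and "0 < \<delta>" "\<delta> < \<alpha>" "\<alpha> \<le> 1"
    and lin: "continuous_linear_operator T" and assoc: "associated_with T K" and T1: "T1_eq_zero T K"
    and I: "I \<in> cubes" and J: "J \<in> cubes" and le: "side J \<le> side I" and near: "rdist I J \<le> 3"
    and weak: "\<And>\<phi> \<eta>. \<phi> \<in> C0 \<Longrightarrow> \<eta> \<in> C0 \<Longrightarrow> bump_order0 J C N \<phi> \<Longrightarrow> bump_order0 J C N \<eta>
      \<Longrightarrow> cmod (T \<phi> \<eta>) \<le> A * C\<^sup>2 * F\<^sub>W"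
    and "0 < C" and bI: "bump_order1 I C N \<alpha> \<psi>\<^sub>I" and bJ: "bump_order1 J C N \<alpha> \<psi>\<^sub>J"
    and sI: "supp \<psi>\<^sub>I \<subseteq> cube_set I" and sJ: "supp \<psi>\<^sub>J \<subseteq> cube_set J"
    and zero: "integral\<^sup>L lborel \<psi>\<^sub>J = 0"
  defines "n \<equiv> CARD('n)"
  shows "cmod (T \<psi>\<^sub>I \<psi>\<^sub>J) \<le> C\<^sup>2 * (side J / side I) powr (real n / 2 + \<delta>)
      * (2 * real n * (1 + 2 * real n) powr real N * A * F\<^sub>W
        + B * 2 powr (2 * real n + \<delta>) / (1 - 2 powr (\<delta> - \<alpha>))
            * (L (side J) * S (side J) * D (1 / 10 * rdist I unit_cube))
        + B * 2 * 4 ^ n * (L (side I) * S (side J)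
            * (\<Sum>j. 2 powr (- (real j * \<delta>)) * D (1 / 10 * rdist (dilate (2 ^ j) I) unit_cube))))"
proof -
  have s: "0 < side I" "0 < side J" using I J by (auto simp: cubes_def)
  define c where "c = center J"
  define R where "R = 2 * real n"
  have R: "1 \<le> R" by (simp add: R_def n_def) (use zero_less_card_finite[where 'a='n] in linarith)
  obtain \<Phi> where \<Phi>: "smooth \<Phi>" "\<And>t. 0 \<le> \<Phi> t \<and> \<Phi> t \<le> 1"
    "\<And>t. infnorm (t - c) \<le> side J \<Longrightarrow> \<Phi> t = 1"
    "\<And>t. R * side J < infnorm (t - c) \<Longrightarrow> \<Phi> t = 0"
    using smooth_cutoff[OF s(2), of c] unfolding R_def n_def by blast
  have cont: "continuous_on UNIV \<Phi>"
    using \<Phi>(1) unfolding smooth_def by (intro C_k_continuous[of 0]) blast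
  have \<Phi>_supp: "supp \<Phi> \<subseteq> {t. infnorm (t - c) \<le> R * side J}" "supp (\<lambda>t. complex_of_real (\<Phi> t)) \<subseteq> {t. infnorm (t - c) \<le> R * side J}"
    unfolding infnorm_cball_eq_cbox
    by (rule supp_subset_closed[OF closed_cbox]; use \<Phi>(4) in \<open>force simp flip: infnorm_cball_eq_cbox\<close>)+
  have \<Phi>_compact: "compact (supp \<Phi>)"
    using compact_Int_closed[OF compact_cbox, of "supp \<Phi>" "c - vec (R * side J)" "c + vec (R * side J)"] \<Phi>_supp(1)
    unfolding infnorm_cball_eq_cbox by (simp add: inf.absorb2 supp_def)
  define \<phi> where "\<phi> = (\<lambda>t. complex_of_real (\<Phi> t))"
  have C0: "\<psi>\<^sub>I \<in> C0" "\<psi>\<^sub>J \<in> C0"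
    using bI bJ sI sJ by (auto intro!: C0_of_compact compact_cube_set simp: bump_order1_def)
  have contI: "continuous_on UNIV \<psi>\<^sub>I" using bI by (simp add: bump_order1_def)
  have \<phi>C0: "\<phi> \<in> C0"
    using cont \<Phi>_supp(2) unfolding \<phi>_def infnorm_cball_eq_cbox
    by (intro C0_of_compact[OF _ compact_cbox]) (auto intro!: continuous_intros)
  define f1 where "f1 = (\<lambda>t. (\<psi>\<^sub>I t - \<psi>\<^sub>I c) * \<phi> t)"
  define f2 where "f2 = (\<lambda>t. (1 - \<phi> t) * \<psi>\<^sub>I t)"
  have f1: "f1 \<in> C0"
    unfolding f1_def using contI by (intro C0_mult_left \<phi>C0 continuous_intros)
  have f2: "f2 \<in> C0"
    unfolding f2_def \<phi>_def using cont by (intro C0_mult_left C0 continuous_intros)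
  have f3: "(\<lambda>t. \<psi>\<^sub>I c * \<phi> t) \<in> C0" by (intro C0_mult_left \<phi>C0 continuous_intros)
  have "\<psi>\<^sub>I = (\<lambda>t. f1 t + (f2 t + \<psi>\<^sub>I c * \<phi> t))" by (auto simp: f1_def f2_def algebra_simps)
  then have "T \<psi>\<^sub>I \<psi>\<^sub>J = T (\<lambda>t. f1 t + (f2 t + \<psi>\<^sub>I c * \<phi> t)) \<psi>\<^sub>J" by simp
  also have "\<dots> = T f1 \<psi>\<^sub>J + (T f2 \<psi>\<^sub>J + \<psi>\<^sub>I c * T \<phi> \<psi>\<^sub>J)"
    using f1 f2 f3 \<phi>C0 C0(2) by (simp add: operator_linear[OF lin] C0_add)
  finally have split: "T \<psi>\<^sub>I \<psi>\<^sub>J = T f1 \<psi>\<^sub>J + (T f2 \<psi>\<^sub>J + \<psi>\<^sub>I c * T \<phi> \<psi>\<^sub>J)" .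

  define E where "E = (\<lambda>(x, t). complex_of_real (1 - \<Phi> t) * (\<psi>\<^sub>I t - \<psi>\<^sub>I c) * \<psi>\<^sub>J x * (K x t - K c t))"
  define F where "F = (\<lambda>(x, t). f2 t * \<psi>\<^sub>J x * (K x t - K c t))"
  define W where "W = (\<lambda>(x, t). complex_of_real (1 - \<Phi> t) * \<psi>\<^sub>J x * (K x t - K c t))"
  note rem = remainder_estimate[OF reg \<open>0 < \<delta>\<close> \<open>\<delta> < \<alpha>\<close> I J le near \<open>0 < C\<close> bI bJ sJ cont \<Phi>(2) \<Phi>(3)[unfolded c_def]]
  have E_int: "integrable (lborel \<Otimes>\<^sub>M lborel) E"
    using rem(1) unfolding E_def c_def .
  \<comment> \<open>The cutoff is 1 up to distance l(J) from c, but \<open>J\<close> reaches only to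
    l(J)/2. This gap keeps the supports disjoint even after closure.\<close>
  have f2_supp: "supp f2 \<subseteq> {t. side J \<le> infnorm (t - c)}"
  proof (rule supp_subset_closed)
    show "closed {t. side J \<le> infnorm (t - c)}"
      by (intro closed_Collect_le continuous_intros)
    show "t \<in> {t. side J \<le> infnorm (t - c)}" if "f2 t \<noteq> 0" for t
      using that \<Phi>(3)[of t] by (force simp: f2_def \<phi>_def)
  qed
  have disj: "supp f2 \<inter> supp \<psi>\<^sub>J = {}" "c \<notin> supp f2"
    using f2_supp sJ s by (force simp: mem_cube_set c_def infnorm_0)+
  note pF = pairing_kernel_difference[OF assoc continuous_on_kernel[OF reg \<open>0 < \<delta>\<close>] f2 C0(2) disj zero, folded F_def]
  have "T1_pairing T K J \<Phi> \<psi>\<^sub>J = 0"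
    using T1 J C0(2) sJ zero \<Phi>(1-3) \<Phi>_compact unfolding T1_eq_zero_def c_def by blast
  then have TW: "T \<phi> \<psi>\<^sub>J = - (LINT x|lborel. LINT t|lborel. W (x, t))"
    by (simp add: T1_pairing_def \<phi>_def W_def c_def add_eq_0_iff2)
  \<comment> \<open>\<open>T1_pairing\<close> contains an iterated integral. Integrability of
    \<open>\<psi>\<^sub>I c * W\<close> on the product is inherited from \<open>F\<close> and
    \<open>E\<close>, so Fubini applies to this multiple, and the scalar is then pulled out of the
    iterated integral.\<close>
  have FE: "(\<lambda>z. F z - E z) = (\<lambda>z. \<psi>\<^sub>I c * W z)"
    by (auto simp: F_def E_def W_def f2_def \<phi>_def algebra_simps)
  have "integral\<^sup>L (lborel \<Otimes>\<^sub>M lborel) F - integral\<^sup>L (lborel \<Otimes>\<^sub>M lborel) E = integral\<^sup>L (lborel \<Otimes>\<^sub>M lborel) (\<lambda>z. \<psi>\<^sub>I c * W z)"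
    unfolding FE[symmetric] using pF(1) E_int by simp
  also have "\<dots> = (LINT x|lborel. LINT t|lborel. \<psi>\<^sub>I c * W (x, t))"
    using Bochner_Integration.integrable_diff[OF pF(1) E_int]
    by (intro lborel_pair.integral_fst'[symmetric]) (simp add: FE)
  also have "\<dots> = - (\<psi>\<^sub>I c * T \<phi> \<psi>\<^sub>J)" by (simp add: TW)
  finally have remainder: "T f2 \<psi>\<^sub>J + \<psi>\<^sub>I c * T \<phi> \<psi>\<^sub>J = integral\<^sup>L (lborel \<Otimes>\<^sub>M lborel) E"
    using pF(2) by (simp add: algebra_simps)

  define \<rho> where "\<rho> = (side J / side I) powr (real n / 2 + \<delta>)"
  \<comment> \<open>Chosen so that \<open>f1\<close> divided by \<sigma> is a bump adapted to
    \<open>J\<close> with the same constant \<open>C\<close>: R dominates R^\<alpha>, and (1+R)^N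
    compensates the decay weight on the support of the cutoff.\<close>
  define \<sigma> where "\<sigma> = R * (1 + R) powr real N * \<rho>"
  have \<sigma>: "0 < \<sigma>" "0 < \<rho>" using R s by (auto simp: \<sigma>_def \<rho>_def)
  define vI where "vI = cube_vol I powr (-1/2)"
  define vJ where "vJ = cube_vol J powr (-1/2)"
  \<comment> \<open>Converts the normalization of \<open>I\<close> into that of \<open>J\<close>;
    the ratio of the two is (l(J)/l(I))^(n/2).\<close>
  have vIJ: "vI * (side J / side I) powr \<delta> = vJ * \<rho>"
  proof -
    have "vI = side I powr (- (real n / 2))" "vJ = side J powr (- (real n / 2))"
      unfolding vI_def vJ_def cube_vol_powr[OF I] cube_vol_powr[OF J] n_def by simp_all
    moreover have "side J powr (- (real n / 2)) * side J powr (real n / 2) = 1"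
      using s by (simp add: powr_add[symmetric])
    ultimately show ?thesis
      using s by (simp add: \<rho>_def powr_add powr_divide powr_minus_divide)
  qed
  have f1_bound: "cmod (f1 t) \<le> \<sigma> * (C * vJ * (1 + infnorm (t - c) / side J) powr (- real N))" for t
  proof (cases "R * side J < infnorm (t - c)")
    case True
    then show ?thesis
      using \<Phi>(4)[of t] \<sigma> \<open>0 < C\<close> by (simp add: f1_def \<phi>_def vJ_def)
  next
    case False
    have pos: "0 \<le> infnorm (t - c)" by (rule infnorm_pos_le)
    have "cmod (f1 t) = \<bar>\<Phi> t\<bar> * cmod (\<psi>\<^sub>I t - \<psi>\<^sub>I c)" by (simp add: f1_def \<phi>_def norm_mult)
    also have "\<dots> \<le> 1 * (C * vI * (infnorm (t - c) / side I) powr \<alpha>)"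
      using \<Phi>(2)[of t] bump_order1_diff_le[OF bI I \<open>0 < C\<close>, of t c]
      by (intro mult_mono) (auto simp: vI_def)
    also have "\<dots> \<le> C * vI * (R * (side J / side I) powr \<delta>)"
    proof -
      have "(infnorm (t - c) / side I) powr \<alpha> \<le> (R * (side J / side I)) powr \<alpha>"
        using False pos s \<open>0 < \<delta>\<close> \<open>\<delta> < \<alpha>\<close> by (intro powr_mono2) (auto simp: field_simps)
      also have "\<dots> = R powr \<alpha> * (side J / side I) powr \<alpha>"
        by (rule powr_mult)
      \<comment> \<open>Here R \<ge> 1 with \<alpha> \<le> 1, and l(J)/l(I) \<le> 1 with \<delta> <
        \<alpha>.\<close>
      also have "\<dots> \<le> R powr 1 * (side J / side I) powr \<delta>"
        using R s le \<open>\<delta> < \<alpha>\<close> \<open>\<alpha> \<le> 1\<close> by (intro mult_mono powr_mono powr_mono') auto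
      finally show ?thesis using R \<open>0 < C\<close> by (simp add: vI_def mult_left_mono)
    qed
    also have "\<dots> = R * \<rho> * C * vJ * ((1 + R) powr real N * (1 + R) powr (- real N))"
      using R vIJ by (simp add: powr_add[symmetric] mult_ac)
    also have "\<dots> = \<sigma> * (C * vJ * (1 + R) powr (- real N))" by (simp add: \<sigma>_def mult_ac)
    also have "\<dots> \<le> \<sigma> * (C * vJ * (1 + infnorm (t - c) / side J) powr (- real N))"
      using False pos s \<sigma> \<open>0 < C\<close>
      by (intro mult_left_mono powr_mono2') (auto simp: vJ_def field_simps)
    finally show ?thesis .
  qed
  have f1': "(\<lambda>t. 1 / \<sigma> * f1 t) \<in> C0" by (intro C0_mult_left f1 continuous_intros)
  have "bump_order0 J C N (\<lambda>t. 1 / \<sigma> * f1 t)"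
  proof -
    have *: "cmod (1 / \<sigma> * f1 t) \<le> C * vJ * (1 + infnorm (t - c) / side J) powr (- real N)" for t
      using f1_bound[of t] \<sigma> by (simp add: norm_mult norm_divide field_simps)
    have "cmod (1 / \<sigma> * f1 t) \<le> C * vJ * 1" for t
      using \<open>0 < C\<close> decay_le_1[OF J, of t N]
      by (intro order_trans[OF *] mult_left_mono) (auto simp: vJ_def c_def)
    then have "bounded (range (\<lambda>t. 1 / \<sigma> * f1 t))" unfolding bounded_iff by blast
    with * show ?thesis by (simp add: bump_order0_def vJ_def c_def)
  qed
  then have "cmod (T (\<lambda>t. 1 / \<sigma> * f1 t) \<psi>\<^sub>J) \<le> A * C\<^sup>2 * F\<^sub>W"
    using bJ by (intro weak f1' C0) (auto simp: bump_order1_def)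
  moreover have "T (\<lambda>t. 1 / \<sigma> * f1 t) \<psi>\<^sub>J = 1 / \<sigma> * T f1 \<psi>\<^sub>J"
    by (rule operator_linear(2)[OF lin C0(2) f1])
  ultimately have "1 / \<sigma> * cmod (T f1 \<psi>\<^sub>J) \<le> A * C\<^sup>2 * F\<^sub>W"
    using \<sigma> by (simp add: norm_mult norm_divide)
  then have main: "cmod (T f1 \<psi>\<^sub>J) \<le> \<sigma> * (A * C\<^sup>2 * F\<^sub>W)"
    using \<sigma> by (simp add: pos_divide_le_eq mult.commute)

  have "cmod (T \<psi>\<^sub>I \<psi>\<^sub>J) \<le> cmod (T f1 \<psi>\<^sub>J) + cmod (integral\<^sup>L (lborel \<Otimes>\<^sub>M lborel) E)"
    unfolding split remainder by (rule norm_triangle_ineq)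
  also have "\<dots> \<le> \<sigma> * (A * C\<^sup>2 * F\<^sub>W) + B * C\<^sup>2 * \<rho> * S (side J)
        * (2 powr (2 * real n + \<delta>) / (1 - 2 powr (\<delta> - \<alpha>)) * (L (side J) * D (1 / 10 * rdist I unit_cube))
           + 2 * 4 ^ n * (L (side I)
               * (\<Sum>j. 2 powr (- (real j * \<delta>)) * D (1 / 10 * rdist (dilate (2 ^ j) I) unit_cube))))"
    using main rem(2) unfolding \<rho>_def E_def c_def n_def by (rule add_mono)
  also have "\<dots> = C\<^sup>2 * \<rho> * (R * (1 + R) powr real N * A * F\<^sub>W
        + B * 2 powr (2 * real n + \<delta>) / (1 - 2 powr (\<delta> - \<alpha>))
            * (L (side J) * S (side J) * D (1 / 10 * rdist I unit_cube))
        + B * 2 * 4 ^ n * (L (side I) * S (side J)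
            * (\<Sum>j. 2 powr (- (real j * \<delta>)) * D (1 / 10 * rdist (dilate (2 ^ j) I) unit_cube))))"
    by (simp add: \<sigma>_def distrib_left mult_ac)
  finally show ?thesis unfolding \<rho>_def R_def .
qed

subsection \<open>Adjoints\<close>

lemma adjoint_continuous_linear_operator:
  assumes "continuous_linear_operator T"
  shows "continuous_linear_operator (adjoint_operator T)"
proof -
  have "adjoint_operator T f = (\<lambda>g. T g f)" for f
    by (simp add: fun_eq_iff adjoint_operator_def)
  then show ?thesis
    using assms by (simp add: continuous_linear_operator_def)
qed

lemma weak_compactness_adjoint:
  assumes "weak_compactness T N F\<^sub>W"
  shows "weak_compactness (adjoint_operator T) N F\<^sub>W"
proof -
  obtain A where "\<forall>I\<in>cubes. \<forall>C>0. \<forall>\<phi>\<in>C0. \<forall>\<eta>\<in>C0.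
        bump_order0 I C N \<phi> \<and> bump_order0 I C N \<eta> \<longrightarrow> cmod (T \<phi> \<eta>) \<le> A * C\<^sup>2 * F\<^sub>W I"
    using assms unfolding weak_compactness_def by blast
  then have "\<forall>I\<in>cubes. \<forall>C>0. \<forall>\<phi>\<in>C0. \<forall>\<eta>\<in>C0.
        bump_order0 I C N \<phi> \<and> bump_order0 I C N \<eta> \<longrightarrow> cmod (adjoint_operator T \<phi> \<eta>) \<le> A * C\<^sup>2 * F\<^sub>W I"
    by (simp add: adjoint_operator_def)
  with assms show ?thesis unfolding weak_compactness_def by blast
qed

section \<open>The combined bound and the reduction by duality\<close>

definition F_bound ::
    "real \<Rightarrow> (real \<Rightarrow> real) \<Rightarrow> (real \<Rightarrow> real) \<Rightarrow> (real \<Rightarrow> real) \<Rightarrow> ('n cube \<Rightarrow> real) \<Rightarrow>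
     ('n::{finite,linorder}) cube \<Rightarrow> 'n cube \<Rightarrow> real" where
  "F_bound \<delta> L S D F\<^sub>W I J =
    (if rdist I J > 3 then F_K L S D (cube_hull I J) (cube_meet I J) (cube_hull I J)
     else F_K_tilde \<delta> L S D (cube_join I J) (cube_meet I J) (cube_join I J)
       + F\<^sub>W (cube_meet I J) + F_K L S D (cube_meet I J) (cube_meet I J) (cube_join I J))"

text \<open>Equal sides are excluded because the tie-breaking rule then makes the meet the second
  argument, so exchanging the cubes changes it.\<close>

lemma F_bound_commute:
  "side I \<noteq> side J \<Longrightarrow> F_bound \<delta> L S D F\<^sub>W I J = F_bound \<delta> L S D F\<^sub>W J I"
  by (simp add: F_bound_def rdist_commute[of J] cube_hull_commute[of J] cube_meet_def cube_join_def)

text \<open>Allows constants to be enlarged. The literal \<open>1 / 10\<close> is kept so that the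
  functions match those of the theorem at \<kappa> = 1/10.\<close>

lemma F_bound_nonneg:
  assumes adm: "admissible_functions L S D" and "0 < \<delta>" "weak_compactness T N F\<^sub>W"
    "I \<in> cubes" "J \<in> cubes"
  shows "0 \<le> F_bound \<delta> (\<lambda>y. L (1 / 10 * y)) (\<lambda>y. S (y / (1 / 10))) (\<lambda>y. D (1 / 10 * y)) F\<^sub>W I J"
proof -
  have s: "0 < side I" "0 < side J" using assms(4,5) by (auto simp: cubes_def)
  have K: "0 \<le> F_K (\<lambda>y. L (1 / 10 * y)) (\<lambda>y. S (y / (1 / 10))) (\<lambda>y. D (1 / 10 * y)) P Q R"
    if "P \<in> cubes" "Q \<in> cubes" "R \<in> cubes" for P Q R :: "'a cube"
    using that rdist_unit_cube_nonneg[of R] unfolding F_K_def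
    by (intro mult_nonneg_nonneg admissible_functionsD[OF adm]) (auto simp: cubes_def)
  have t: "0 \<le> F_K_tilde \<delta> (\<lambda>y. L (1 / 10 * y)) (\<lambda>y. S (y / (1 / 10))) (\<lambda>y. D (1 / 10 * y)) P Q R"
    if "P \<in> cubes" "Q \<in> cubes" "R \<in> cubes" for P Q R :: "'a cube"
    using that rdist_unit_cube_nonneg[OF dilate_mem_cubes[OF that(3)]] unfolding F_K_tilde_def
    by (intro mult_nonneg_nonneg suminf_nonneg summable_F_K_tilde[OF adm \<open>0 < \<delta>\<close>] admissible_functionsD[OF adm])
      (auto simp: cubes_def)
  have "cube_meet I J \<in> cubes" "cube_join I J \<in> cubes" "cube_hull I J \<in> cubes"
    using assms(4,5) max_side_le_hull[OF assms(4,5)] by (auto simp: cube_meet_def cube_join_def cubes_def)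
  then show ?thesis
    using K t assms(3) unfolding F_bound_def weak_compactness_def by auto
qed

text \<open>Both regimes for a smaller second cube, under one constant chosen before cubes and
  bumps. Nonnegativity of \<open>A\<close> is recorded so that the constants of \<open>T\<close> and
  its adjoint can be added.\<close>

lemma ordered_estimate:
  fixes K :: "real^('n::{finite,linorder}) \<Rightarrow> real^('n::{finite,linorder}) \<Rightarrow> complex"
    and F\<^sub>W :: "('n::{finite,linorder}) cube \<Rightarrow> real"
  assumes "0 < \<delta>" and CZ: "compact_CZ_kernel K \<delta> L S D" and lin: "continuous_linear_operator T"
    and assoc: "associated_with T K" and weak: "weak_compactness T N F\<^sub>W" and T1: "T1_eq_zero T K"
    and "\<delta> < \<alpha>" "\<alpha> \<le> 1"
  obtains A where "0 \<le> A"
    "\<And>I J C \<psi>\<^sub>I \<psi>\<^sub>J. I \<in> cubes \<Longrightarrow> J \<in> cubes \<Longrightarrow> side J \<le> side I \<Longrightarrow> 0 < C \<Longrightarrow>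
      bump_order1 I C N \<alpha> \<psi>\<^sub>I \<Longrightarrow> supp \<psi>\<^sub>I \<subseteq> cube_set I \<Longrightarrow>
      bump_order1 J C N \<alpha> \<psi>\<^sub>J \<Longrightarrow> supp \<psi>\<^sub>J \<subseteq> cube_set J \<Longrightarrow> integral\<^sup>L lborel \<psi>\<^sub>J = 0 \<Longrightarrow>
      cmod (T \<psi>\<^sub>I \<psi>\<^sub>J) \<le> A * C\<^sup>2
        * (ec I J powr (1/2 + \<delta> / real CARD('n)) / rdist I J powr (real CARD('n) + \<delta>))
        * F_bound \<delta> (\<lambda>y. L (1 / 10 * y)) (\<lambda>y. S (y / (1 / 10))) (\<lambda>y. D (1 / 10 * y)) F\<^sub>W I J"
proof -
  obtain B where reg: "kernel_regularity K \<delta> L S D B"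
    using compact_CZ_kernel_regularity[OF CZ] .
  note adm = kernel_regularityD(1)[OF reg]
  have B: "0 < B" by (rule kernel_regularityD(2)[OF reg])
  obtain A0 where A0: "\<And>I C \<phi> \<eta>. I \<in> cubes \<Longrightarrow> 0 < C \<Longrightarrow> \<phi> \<in> C0 \<Longrightarrow> \<eta> \<in> C0 \<Longrightarrow>
        bump_order0 I C N \<phi> \<Longrightarrow> bump_order0 I C N \<eta> \<Longrightarrow> cmod (T \<phi> \<eta>) \<le> A0 * C\<^sup>2 * F\<^sub>W I"
    using weak unfolding weak_compactness_def by blast
  have FW: "0 \<le> F\<^sub>W I" if "I \<in> cubes" for I
    using weak that unfolding weak_compactness_def by blast
  define n where "n = CARD('n)"
  \<comment> \<open>Weak compactness gives no sign for its constant; the absolute value makes all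
    coefficients nonnegative.\<close>
  define A1 where "A1 = 2 * real n * (1 + 2 * real n) powr real N * \<bar>A0\<bar>"
  define A2 where "A2 = B * 2 powr (2 * real n + \<delta>) / (1 - 2 powr (\<delta> - \<alpha>))"
  define A3 where "A3 = B * 2 * 4 ^ n"
  define A4 where "A4 = 3 powr (real n + \<delta>) * B"
  have "2 powr (\<delta> - \<alpha>) < (1::real)"
    using \<open>\<delta> < \<alpha>\<close> powr_less_mono[of "\<delta> - \<alpha>" 0 "2::real"] by simp
  then have nonneg: "0 \<le> A1" "0 \<le> A2" "0 \<le> A3" "0 \<le> A4"
    using B by (auto simp: A1_def A2_def A3_def A4_def)
  define A where "A = A4 + (A1 + A2 + A3) * 3 powr (real n + \<delta>)"
  show ?thesis
  proof (rule that[of A])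
    show A_nonneg: "0 \<le> A" using nonneg by (simp add: A_def)
    fix I J :: "'n cube" and C \<psi>\<^sub>I \<psi>\<^sub>J
    assume I: "I \<in> cubes" and J: "J \<in> cubes" and le: "side J \<le> side I" and "0 < C"
      and bI: "bump_order1 I C N \<alpha> \<psi>\<^sub>I" and sI: "supp \<psi>\<^sub>I \<subseteq> cube_set I"
      and bJ: "bump_order1 J C N \<alpha> \<psi>\<^sub>J" and sJ: "supp \<psi>\<^sub>J \<subseteq> cube_set J"
      and zero: "integral\<^sup>L lborel \<psi>\<^sub>J = 0"
    have s: "0 < side I" "0 < side J" using I J by (auto simp: cubes_def)
    let ?\<rho> = "(side J / side I) powr (real n / 2 + \<delta>)"
    let ?L = "\<lambda>y. L (1 / 10 * y)" and ?S = "\<lambda>y. S (y / (1 / 10))" and ?D = "\<lambda>y. D (1 / 10 * y)"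
    let ?r = "rdist I J powr (real n + \<delta>)"
    have ec: "ec I J powr (1/2 + \<delta> / real n) = ?\<rho>"
      unfolding n_def by (rule ec_powr[OF I J le])
    have mj: "cube_meet I J = J" "cube_join I J = I" using le by (simp_all add: cube_meet_def cube_join_def)
    \<comment> \<open>Monotonicity only enlarges the bounds here: it brings factors that arose
      undilated under the common constant 1/10.\<close>
    have S: "S (side J) \<le> S (side J / (1 / 10))" "0 \<le> S (side J)"
      using s by (auto intro!: admissible_functionsD[OF adm])
    have L: "L (side Q) \<le> L (1 / 10 * side Q)" "0 \<le> L (side Q)" if "0 < side Q" for Q :: "'n cube"
      using that by (auto intro!: admissible_functionsD[OF adm])
    have D: "0 \<le> D (1 / 10 * rdist Q unit_cube)" if "Q \<in> cubes" for Q :: "'n cube"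
      using rdist_unit_cube_nonneg[OF that] by (auto intro!: admissible_functionsD[OF adm])
    have F: "0 \<le> F_bound \<delta> ?L ?S ?D F\<^sub>W I J"
      by (rule F_bound_nonneg[OF adm \<open>0 < \<delta>\<close> weak I J])
    have r: "0 < ?r" using rdist_ge_1[OF I J] by simp
    have "cmod (T \<psi>\<^sub>I \<psi>\<^sub>J) \<le> A * C\<^sup>2 * (?\<rho> / ?r) * F_bound \<delta> ?L ?S ?D F\<^sub>W I J"
    proof (cases "3 < rdist I J")
      case True
      define H where "H = cube_hull I J"
      have H: "H \<in> cubes" using max_side_le_hull[OF I J] s by (simp add: H_def cubes_def)
      then have sH: "0 < side H" by (simp add: cubes_def)
      have "cmod (T \<psi>\<^sub>I \<psi>\<^sub>J) \<le> A4 * C\<^sup>2 * (?\<rho> / ?r)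
          * (L (1 / 10 * side H) * S (side J) * D (1 / 10 * rdist H unit_cube))"
        unfolding A4_def n_def H_def
        by (rule far_estimate[OF reg \<open>0 < \<delta>\<close> assoc I J le True \<open>0 < C\<close> bI bJ sI sJ zero])
      also have "\<dots> \<le> A * C\<^sup>2 * (?\<rho> / ?r) * F_bound \<delta> ?L ?S ?D F\<^sub>W I J"
      proof (intro mult_mono mult_right_mono)
        show "A4 \<le> A" using nonneg by (simp add: A_def)
        have "L (1 / 10 * side H) * S (side J) * D (1 / 10 * rdist H unit_cube)
            \<le> ?L (side H) * ?S (side J) * ?D (rdist H unit_cube)"
          using S D[OF H] admissible_functionsD(1)[OF adm, of "1 / 10 * side H"] sH
          by (intro mult_right_mono mult_left_mono) auto
        also have "\<dots> = F_bound \<delta> ?L ?S ?D F\<^sub>W I J"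
          using True by (simp add: F_bound_def F_K_def H_def mj)
        finally show "L (1 / 10 * side H) * S (side J) * D (1 / 10 * rdist H unit_cube)
            \<le> F_bound \<delta> ?L ?S ?D F\<^sub>W I J" .
        show "0 \<le> L (1 / 10 * side H) * S (side J) * D (1 / 10 * rdist H unit_cube)"
          using S D[OF H] admissible_functionsD(1)[OF adm, of "1 / 10 * side H"] sH by simp
      qed (use A_nonneg in auto)
      finally show ?thesis .
    next
      case False
      then have near: "rdist I J \<le> 3" by simp
      define Y where "Y = (\<Sum>j. 2 powr (- (real j * \<delta>)) * D (1 / 10 * rdist (dilate (2 ^ j) I) unit_cube))"
      have Y: "0 \<le> Y"
        unfolding Y_def using D[OF dilate_mem_cubes[OF I]]
        by (intro suminf_nonneg summable_F_K_tilde[OF adm \<open>0 < \<delta>\<close> I]) auto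
      have FJ: "A0 * C\<^sup>2 * F\<^sub>W J \<le> \<bar>A0\<bar> * C\<^sup>2 * F\<^sub>W J"
        using FW[OF J] by (intro mult_right_mono) auto
      have "cmod (T \<psi>\<^sub>I \<psi>\<^sub>J) \<le> C\<^sup>2 * ?\<rho> * (A1 * F\<^sub>W J
          + A2 * (L (side J) * S (side J) * D (1 / 10 * rdist I unit_cube)) + A3 * (L (side I) * S (side J) * Y))"
        unfolding A1_def A2_def A3_def Y_def n_def
        by (rule near_estimate[OF reg \<open>0 < \<delta>\<close> \<open>\<delta> < \<alpha>\<close> \<open>\<alpha> \<le> 1\<close> lin assoc T1 I J le near
              order_trans[OF A0[OF J \<open>0 < C\<close>] FJ] \<open>0 < C\<close> bI bJ sI sJ zero])
      also have "\<dots> \<le> C\<^sup>2 * ?\<rho> * (A1 * F\<^sub>W J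
          + A2 * (?L (side J) * ?S (side J) * ?D (rdist I unit_cube)) + A3 * (?L (side I) * ?S (side J) * Y))"
        using S L[OF s(1)] L[OF s(2)] D[OF I] Y nonneg
        by (intro mult_left_mono add_mono mult_mono mult_nonneg_nonneg) auto
      also have "\<dots> \<le> C\<^sup>2 * ?\<rho> * ((A1 + A2 + A3) * F_bound \<delta> ?L ?S ?D F\<^sub>W I J)"
      proof (rule mult_left_mono)
        define X1 where "X1 = F\<^sub>W J"
        define X2 where "X2 = ?L (side J) * ?S (side J) * ?D (rdist I unit_cube)"
        define X3 where "X3 = ?L (side I) * ?S (side J) * Y"
        have X: "0 \<le> X1" "0 \<le> X2" "0 \<le> X3"
          unfolding X1_def X2_def X3_def using FW[OF J] S L[OF s(1)] L[OF s(2)] D[OF I] Y by auto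
        have Fb: "F_bound \<delta> ?L ?S ?D F\<^sub>W I J = X3 + X1 + X2"
          using False by (simp add: F_bound_def F_K_def F_K_tilde_def mj X1_def X2_def X3_def Y_def)
        have "A1 * X1 + A2 * X2 + A3 * X3 \<le> A1 * (X3 + X1 + X2) + A2 * (X3 + X1 + X2) + A3 * (X3 + X1 + X2)"
          using X nonneg by (intro add_mono mult_left_mono) auto
        then show "A1 * F\<^sub>W J + A2 * (?L (side J) * ?S (side J) * ?D (rdist I unit_cube)) + A3 * (?L (side I) * ?S (side J) * Y)
            \<le> (A1 + A2 + A3) * F_bound \<delta> ?L ?S ?D F\<^sub>W I J"
          unfolding Fb X1_def[symmetric] X2_def[symmetric] X3_def[symmetric] by (simp add: distrib_right)
      qed auto
      also have "\<dots> = (A1 + A2 + A3) * C\<^sup>2 * ?\<rho> * F_bound \<delta> ?L ?S ?D F\<^sub>W I J" by (simp add: mult_ac)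
      also have "\<dots> \<le> ((A1 + A2 + A3) * 3 powr (real n + \<delta>)) * C\<^sup>2 * (?\<rho> / ?r) * F_bound \<delta> ?L ?S ?D F\<^sub>W I J"
      proof (rule mult_right_mono[OF _ F])
        have "?r \<le> 3 powr (real n + \<delta>)"
          using near rdist_ge_1[OF I J] \<open>0 < \<delta>\<close> by (intro powr_mono2) auto
        then have "1 \<le> 3 powr (real n + \<delta>) / ?r" using r by simp
        then have "(A1 + A2 + A3) * C\<^sup>2 * ?\<rho> * 1 \<le> (A1 + A2 + A3) * C\<^sup>2 * ?\<rho> * (3 powr (real n + \<delta>) / ?r)"
          using nonneg by (intro mult_left_mono) auto
        then show "(A1 + A2 + A3) * C\<^sup>2 * ?\<rho> \<le> ((A1 + A2 + A3) * 3 powr (real n + \<delta>)) * C\<^sup>2 * (?\<rho> / ?r)"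
          by (simp add: mult_ac)
      qed
      also have "\<dots> \<le> A * C\<^sup>2 * (?\<rho> / ?r) * F_bound \<delta> ?L ?S ?D F\<^sub>W I J"
        using nonneg F by (intro mult_right_mono) (auto simp: A_def)
      finally show ?thesis .
    qed
    then show "cmod (T \<psi>\<^sub>I \<psi>\<^sub>J) \<le> A * C\<^sup>2
        * (ec I J powr (1/2 + \<delta> / real CARD('n)) / rdist I J powr (real CARD('n) + \<delta>))
        * F_bound \<delta> ?L ?S ?D F\<^sub>W I J"
      using ec by (simp add: n_def)
  qed
qed

theorem proposition3p1:
  fixes \<delta> :: real
  assumes "0 < \<delta>" and "\<delta> < 1"
  shows "\<exists>\<kappa>::real. 0 < \<kappa> \<and> \<kappa> \<le> 1 \<and>
    (\<forall>(K :: real^('n::{finite,linorder}) \<Rightarrow> real^('n::{finite,linorder}) \<Rightarrow> complex) (L :: real \<Rightarrow> real)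
       (S :: real \<Rightarrow> real) (D :: real \<Rightarrow> real)
       (T :: (real^('n::{finite,linorder}) \<Rightarrow> complex) \<Rightarrow> (real^('n::{finite,linorder}) \<Rightarrow> complex) \<Rightarrow> complex)
       (N :: nat) (F\<^sub>W :: 'n cube \<Rightarrow> real) (\<alpha> :: real).
      compact_CZ_kernel K \<delta> L S D \<longrightarrow>
      continuous_linear_operator T \<longrightarrow>
      associated_with T K \<longrightarrow>
      weak_compactness T N F\<^sub>W \<longrightarrow>
      T1_eq_zero T K \<longrightarrow>
      T1_eq_zero (adjoint_operator T) (\<lambda>x t. K t x) \<longrightarrow>
      \<delta> < \<alpha> \<longrightarrow> \<alpha> \<le> 1 \<longrightarrow>
      (\<exists>A::real. \<forall>I\<in>cubes. \<forall>J\<in>cubes. \<forall>C>0. \<forall>\<psi>\<^sub>I \<psi>\<^sub>J.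
         bump_order1 I C N \<alpha> \<psi>\<^sub>I \<longrightarrow> supp \<psi>\<^sub>I \<subseteq> cube_set I \<longrightarrow>
         bump_order1 J C N \<alpha> \<psi>\<^sub>J \<longrightarrow> supp \<psi>\<^sub>J \<subseteq> cube_set J \<longrightarrow>
         integral\<^sup>L lborel (if side J \<le> side I then \<psi>\<^sub>J else \<psi>\<^sub>I) = 0 \<longrightarrow>
         cmod (T \<psi>\<^sub>I \<psi>\<^sub>J)
           \<le> A * C\<^sup>2
              * (ec I J powr (1/2 + \<delta> / real CARD('n)) / rdist I J powr (real CARD('n) + \<delta>))
              * (let L' = (\<lambda>y. L (\<kappa> * y)); S' = (\<lambda>y. S (y / \<kappa>)); D' = (\<lambda>y. D (\<kappa> * y)) in
                 if rdist I J > 3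
                 then F_K L' S' D' (cube_hull I J) (cube_meet I J) (cube_hull I J)
                 else F_K_tilde \<delta> L' S' D' (cube_join I J) (cube_meet I J) (cube_join I J)
                      + F\<^sub>W (cube_meet I J)
                      + F_K L' S' D' (cube_meet I J) (cube_meet I J) (cube_join I J))))"
proof -
  have "\<exists>A. \<forall>I\<in>cubes. \<forall>J\<in>cubes. \<forall>C>0. \<forall>\<psi>\<^sub>I \<psi>\<^sub>J.
      bump_order1 I C N \<alpha> \<psi>\<^sub>I \<longrightarrow> supp \<psi>\<^sub>I \<subseteq> cube_set I \<longrightarrow>
      bump_order1 J C N \<alpha> \<psi>\<^sub>J \<longrightarrow> supp \<psi>\<^sub>J \<subseteq> cube_set J \<longrightarrow>
      integral\<^sup>L lborel (if side J \<le> side I then \<psi>\<^sub>J else \<psi>\<^sub>I) = 0 \<longrightarrow>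
      cmod (T \<psi>\<^sub>I \<psi>\<^sub>J) \<le> A * C\<^sup>2
        * (ec I J powr (1/2 + \<delta> / real CARD('n)) / rdist I J powr (real CARD('n) + \<delta>))
        * F_bound \<delta> (\<lambda>y. L (1 / 10 * y)) (\<lambda>y. S (y / (1 / 10))) (\<lambda>y. D (1 / 10 * y)) F\<^sub>W I J"
    if CZ: "compact_CZ_kernel K \<delta> L S D" and lin: "continuous_linear_operator T"
      and assoc: "associated_with T K" and weak: "weak_compactness T N F\<^sub>W" and T1: "T1_eq_zero T K"
      and T1': "T1_eq_zero (adjoint_operator T) (\<lambda>x t. K t x)" and \<alpha>: "\<delta> < \<alpha>" "\<alpha> \<le> 1"
    for K :: "real^('n::{finite,linorder}) \<Rightarrow> real^('n::{finite,linorder}) \<Rightarrow> complex"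
      and L S D T N and F\<^sub>W :: "'n cube \<Rightarrow> real" and \<alpha>
  proof -
    let ?F = "F_bound \<delta> (\<lambda>y. L (1 / 10 * y)) (\<lambda>y. S (y / (1 / 10))) (\<lambda>y. D (1 / 10 * y)) F\<^sub>W"
    let ?e = "\<lambda>I J. ec I J powr (1/2 + \<delta> / real CARD('n)) / rdist I J powr (real CARD('n) + \<delta>)"
    obtain B where reg: "kernel_regularity K \<delta> L S D B"
      using compact_CZ_kernel_regularity[OF CZ] .
    note adm = kernel_regularityD(1)[OF reg]
    obtain A where A: "0 \<le> A" "\<And>I J C \<psi>\<^sub>I \<psi>\<^sub>J. I \<in> cubes \<Longrightarrow> J \<in> cubes \<Longrightarrow> side J \<le> side I \<Longrightarrow> 0 < C \<Longrightarrow>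
      bump_order1 I C N \<alpha> \<psi>\<^sub>I \<Longrightarrow> supp \<psi>\<^sub>I \<subseteq> cube_set I \<Longrightarrow>
      bump_order1 J C N \<alpha> \<psi>\<^sub>J \<Longrightarrow> supp \<psi>\<^sub>J \<subseteq> cube_set J \<Longrightarrow> integral\<^sup>L lborel \<psi>\<^sub>J = 0 \<Longrightarrow>
      cmod (T \<psi>\<^sub>I \<psi>\<^sub>J) \<le> A * C\<^sup>2 * ?e I J * ?F I J"
      using ordered_estimate[OF \<open>0 < \<delta>\<close> CZ lin assoc weak T1 \<alpha>] by blast
    \<comment> \<open>The case of a smaller first cube: the ordered estimate is applied to the
      adjoint, and the second cancellation condition enters here.\<close>
    obtain A' where A': "0 \<le> A'" "\<And>I J C \<psi>\<^sub>I \<psi>\<^sub>J. I \<in> cubes \<Longrightarrow> J \<in> cubes \<Longrightarrow> side J \<le> side I \<Longrightarrow> 0 < C \<Longrightarrow>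
      bump_order1 I C N \<alpha> \<psi>\<^sub>I \<Longrightarrow> supp \<psi>\<^sub>I \<subseteq> cube_set I \<Longrightarrow>
      bump_order1 J C N \<alpha> \<psi>\<^sub>J \<Longrightarrow> supp \<psi>\<^sub>J \<subseteq> cube_set J \<Longrightarrow> integral\<^sup>L lborel \<psi>\<^sub>J = 0 \<Longrightarrow>
      cmod (adjoint_operator T \<psi>\<^sub>I \<psi>\<^sub>J) \<le> A' * C\<^sup>2 * ?e I J * ?F I J"
      using ordered_estimate[OF \<open>0 < \<delta>\<close> compact_CZ_kernel_swap[OF CZ]
          adjoint_continuous_linear_operator[OF lin]
          associated_with_adjoint[OF assoc continuous_on_kernel[OF reg \<open>0 < \<delta>\<close>]]
          weak_compactness_adjoint[OF weak] T1' \<alpha>] by blast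
    show ?thesis
    proof (intro exI[of _ "A + A'"] ballI allI impI)
      fix I J :: "'n cube" and C :: real and \<psi>\<^sub>I \<psi>\<^sub>J
      assume I: "I \<in> cubes" and J: "J \<in> cubes" and "0 < C"
        and bI: "bump_order1 I C N \<alpha> \<psi>\<^sub>I" "supp \<psi>\<^sub>I \<subseteq> cube_set I"
        and bJ: "bump_order1 J C N \<alpha> \<psi>\<^sub>J" "supp \<psi>\<^sub>J \<subseteq> cube_set J"
        and zero: "integral\<^sup>L lborel (if side J \<le> side I then \<psi>\<^sub>J else \<psi>\<^sub>I) = 0"
      have nn: "0 \<le> ?F I J" by (rule F_bound_nonneg[OF adm \<open>0 < \<delta>\<close> weak I J])
      have "cmod (T \<psi>\<^sub>I \<psi>\<^sub>J) \<le> (if side J \<le> side I then A else A') * C\<^sup>2 * ?e I J * ?F I J"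
      proof (cases "side J \<le> side I")
        case True
        then show ?thesis using A(2)[OF I J True \<open>0 < C\<close> bI bJ] zero by simp
      next
        \<comment> \<open>The sides now differ strictly, so \<open>F_bound_commute\<close> applies
          after the roles of the cubes are exchanged.\<close>
        case False
        then show ?thesis
          using A'(2)[OF J I _ \<open>0 < C\<close> bJ bI] zero F_bound_commute[of J I \<delta>]
          by (simp add: adjoint_operator_def ec_commute[of J] rdist_commute[of J])
      qed
      also have "\<dots> \<le> (A + A') * C\<^sup>2 * ?e I J * ?F I J"
        using A(1) A'(1) nn by (intro mult_right_mono) auto
      finally show "cmod (T \<psi>\<^sub>I \<psi>\<^sub>J) \<le> (A + A') * C\<^sup>2 * ?e I J * ?F I J" .
    qed
  qed
  then show ?thesis
    unfolding F_bound_def by (intro exI[of _ "1 / 10"]) (simp only: Let_def, auto)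
qed

end
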